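(* Let $\bar\ell\in H^1_0(0,T;\mathbb{R}^n)$ be a local optimum of (P), and let $\{\ell_\epsilon\}$ be a sequence (indexed by a sequence of parameters $\epsilon\searrow0$) of local minimizers of the problems $(P_\epsilon)$ such that $\ell_\epsilon\to\bar\ell$ in $H^1_0(0,T;\mathbb{R}^n)$ as $\epsilon\searrow 0$. For each $\epsilon$ let $\xi_\epsilon\in H^1(0,T;\mathbb{R}^n)$ and $\lambda_\epsilon\in L^\infty(0,T;\mathbb{R}^n)$ be the unique adjoint state and multiplier associated with $\ell_\epsilon$, i.e. the unique pair satisfying, with $q_\epsilon:=S_\epsilon(\ell_\epsilon)$ and $z_\epsilon:=-\alpha q_\epsilon+\ell_\epsilon-\kappa(\mathcal{H}(q_\epsilon))$, \begin{align*} &-\dot\xi_\epsilon+\alpha\lambda_\epsilon+[(\kappa\circ\mathcal{H})'(q_\epsilon)]^\star\lambda_\epsilon=j'(q_\epsilon)\ \text{ in }L^2(0,T;\mathbb{R}^n),\qquad \xi_\epsilon(T)=q_\epsilon(T)-q_d,\\ &\lambda^i_\epsilon(t)=\tfrac1\epsilon\chi_{\{z^i_\epsilon>0\}}(t)\xi^i_\epsilon(t)\ \text{a.e. where }z^i_\epsilon(t)\ne0,\qquad 0\le\lambda^i_\epsilon(t)\le\tfrac1\epsilon\xi^i_\epsilon(t)\ \text{a.e. where }z^i_\epsilon(t)=0,\quad i=1,\dots,n,\\ &\int_0^T\langle\lambda_\epsilon,v\rangle_{\mathbb{R}^n}\,dt+(\ell_\epsilon,v)_{H^1(0,T;\mathbb{R}^n)}+(\ell_\epsilon-\bar\ell,v)_{H^1(0,T;\mathbb{R}^n)}=0\quad\forall\,v\in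 H^1_0(0,T;\mathbb{R}^n). \end{align*} Then there exists $C>0$, independent of $\epsilon$, such that $$\|\lambda_\epsilon\|_{W^{-1,\infty}(0,T;\mathbb{R}^n)}\le C\qquad\text{and}\qquad\|\xi_\epsilon\|_{L^\infty(0,T;\mathbb{R}^n)}\le C.$$
   Context: Fix $T>0$, $n\in\mathbb{N}$, $\alpha>0$. $W^{1,p}_0(0,T;\mathbb{R}^n):=\{y\in W^{1,p}(0,T;\mathbb{R}^n):y(0)=0\}$ (only the initial value vanishes), $H^1_0:=W^{1,2}_0$, and $W^{-1,\infty}(0,T;\mathbb{R}^n)$ is the dual of $W^{1,1}_0(0,T;\mathbb{R}^n)$; a function $\lambda\in L^\infty(0,T;\mathbb{R}^n)$ is identified with the functional $v\mapsto\int_0^T\langle\lambda,v\rangle_{\mathbb{R}^n}dt$. $(\cdot,\cdot)_{H^1(0,T;\mathbb{R}^n)}$ is the usual $H^1$ scalar product. Superscript $i$ denotes the $i$-th component; scalar functions act on vectors componentwise; $\chi_A$ is the characteristic function of $A$. Standing assumptions. The history operator is $\mathcal{H}(y)(t):=\int_0^t y(s)\,ds+y_0$, with fixed $y_0\in\mathbb{R}^n$. The function $\kappa:\mathbb{R}\to[0,\infty)$ is Lipschitz continuous, differentiable, and $\kappa'\in W^{1,2}(\mathbb{R})$. The derivative of $\kappa\circ\mathcal{H}$ is $[(\kappa\circ\mathcal{H})'(q)v](t)=\kappa'(\mathcal{H}(q)(t))\int_0^t v(s)\,ds$ (componentwise), and $[(\kappa\circ\mathcal{H})'(q)]^\star$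 is its adjoint as a bounded linear operator on $L^2(0,T;\mathbb{R}^n)$. The functional $j:L^2(0,T;\mathbb{R}^n)\to\mathbb{R}$ is continuously differentiable; $j'(q)$ is identified with an element of $L^2(0,T;\mathbb{R}^n)$. The desired state $q_d\in\mathbb{R}^n$ has nonnegative components. State equations. Let $\mathcal{C}:=\{\eta\in\mathbb{R}^n:\eta_i\ge0\ \forall i\}$. For $\epsilon>0$ let $\mathcal{R}(\zeta,\eta):=\langle\kappa(\zeta),\eta\rangle_{\mathbb{R}^n}$ and $\mathcal{R}_\epsilon(\zeta,\eta):=\langle\kappa(\zeta),\eta\rangle_{\mathbb{R}^n}+\frac\epsilon2\|\eta\|^2_{\mathbb{R}^n}$ if $\eta\in\mathcal{C}$, and both are $\infty$ otherwise. With $\partial_2$ the convex subdifferential in the second argument: (a) for $\ell\in H^1_0(0,T;\mathbb{R}^n)$, $S(\ell)\in H^1_0(0,T;\mathbb{R}^n)$ is the unique $q$ with $-\alpha q(t)+\ell(t)\in\partial_2\mathcal{R}(\mathcal{H}(q)(t),\dot q(t))$ a.e. in $(0,T)$, $q(0)=0$; (b) for $\ell\in L^2(0,T;\mathbb{R}^n)$, $S_\epsilon(\ell)\in H^1_0(0,T;\mathbb{R}^n)$ is the unique $q$ with $-\alpha q(t)+\ell(t)\in\partial_2\mathcal{R}_\epsilon(\mathcal{H}(q)(t),\dot q(t))$ a.e. in $(0,T)$, $q(0)=0$; equivalently (known), $\dot q(t)=\frac1\epsilon\max\{-\alpha q(t)+\ell(t)-\kappa(\mathcal{H}(q)(t)),0\}$,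 $q(0)=0$. (Unique solvability of both problems is known and may be assumed.) Control problems. (P): minimize $\mathcal{J}(\ell):=j(S(\ell))+\frac12\|S(\ell)(T)-q_d\|_{\mathbb{R}^n}^2+\frac12\|\ell\|^2_{H^1(0,T;\mathbb{R}^n)}$ over $\ell\in H^1_0(0,T;\mathbb{R}^n)$. $(P_\epsilon)$: for the fixed local optimum $\bar\ell$ of (P), minimize $\mathcal{J}_\epsilon(\ell):=j(S_\epsilon(\ell))+\frac12\|S_\epsilon(\ell)(T)-q_d\|_{\mathbb{R}^n}^2+\frac12\|\ell\|^2_{H^1(0,T;\mathbb{R}^n)}+\frac12\|\ell-\bar\ell\|^2_{H^1(0,T;\mathbb{R}^n)}$ over $\ell\in H^1_0(0,T;\mathbb{R}^n)$. Local optimality means minimality on some ball of positive radius in $H^1_0(0,T;\mathbb{R}^n)$ (with respect to the $H^1$ norm) around the point. *)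

theory Defs
  imports "HOL-Probability.Probability"
begin

section \<open>Lebesgue and Sobolev spaces on subsets of the real line\<close>

text \<open>
  Elements of the function spaces are represented by functions defined on all of \<open>real\<close>; only
  their values on the underlying set (almost everywhere) matter.
\<close>

definition Lp :: "real set \<Rightarrow> real \<Rightarrow> (real \<Rightarrow> 'a::euclidean_space) set" where
  "Lp D p = {f. f \<in> borel_measurable (lebesgue_on D) \<and>
                integrable (lebesgue_on D) (\<lambda>t. norm (f t) powr p)}"

definition Lp_norm :: "real set \<Rightarrow> real \<Rightarrow> (real \<Rightarrow> 'a::euclidean_space) \<Rightarrow> real" where
  "Lp_norm D p f = (LINT t|lebesgue_on D. norm (f t) powr p) powr (1 / p)"

definition Linf_norm :: "real set \<Rightarrow> (real \<Rightarrow> 'a::euclidean_space) \<Rightarrow> ereal" where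
  "Linf_norm D f = esssup (lebesgue_on D) (\<lambda>t. ereal (norm (f t)))"

definition Linf :: "real set \<Rightarrow> (real \<Rightarrow> 'a::euclidean_space) set" where
  "Linf D = {f. f \<in> borel_measurable (lebesgue_on D) \<and> Linf_norm D f < \<infinity>}"

definition L2_inner :: "real set \<Rightarrow> (real \<Rightarrow> 'a::euclidean_space) \<Rightarrow> (real \<Rightarrow> 'a) \<Rightarrow> real" where
  "L2_inner D f g = (LINT t|lebesgue_on D. f t \<bullet> g t)"

definition locally_integrable :: "real set \<Rightarrow> (real \<Rightarrow> 'a::euclidean_space) \<Rightarrow> bool" where
  "locally_integrable D f \<longleftrightarrow> (\<forall>K. compact K \<and> K \<subseteq> D \<longrightarrow> integrable (lebesgue_on K) f)"

text \<open>
  \<open>test_function D \<phi> \<phi>'\<close>: \<open>\<phi>\<close> is continuously differentiable with derivative \<open>\<phi>'\<close> and has compact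
  support in \<open>D\<close>. Testing with \<open>C\<^sub>c\<^sup>1\<close> functions is Brezis' definition of one-dimensional Sobolev
  spaces; by mollification, \<open>C\<^sub>c\<^sup>\<infinity>\<close> test functions give the same spaces.
\<close>
definition test_function :: "real set \<Rightarrow> (real \<Rightarrow> real) \<Rightarrow> (real \<Rightarrow> real) \<Rightarrow> bool" where
  "test_function D \<phi> \<phi>' \<longleftrightarrow>
     (\<forall>t. (\<phi> has_real_derivative \<phi>' t) (at t)) \<and> continuous_on UNIV \<phi>' \<and>
     (\<exists>K. compact K \<and> K \<subseteq> D \<and> (\<forall>t. t \<notin> K \<longrightarrow> \<phi> t = 0))"

definition has_weak_deriv ::
  "real set \<Rightarrow> (real \<Rightarrow> 'a::euclidean_space) \<Rightarrow> (real \<Rightarrow> 'a) \<Rightarrow> bool" where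
  "has_weak_deriv D y g \<longleftrightarrow> locally_integrable D y \<and> locally_integrable D g \<and>
     (\<forall>\<phi> \<phi>'. test_function D \<phi> \<phi>' \<longrightarrow>
        (LINT t|lebesgue_on D. \<phi>' t *\<^sub>R y t) = - (LINT t|lebesgue_on D. \<phi> t *\<^sub>R g t))"

text \<open>On an open set, the weak derivative is unique up to a null set.\<close>
definition weak_deriv :: "real set \<Rightarrow> (real \<Rightarrow> 'a::euclidean_space) \<Rightarrow> (real \<Rightarrow> 'a)" where
  "weak_deriv D y = (SOME g. has_weak_deriv D y g)"

definition W1p :: "real set \<Rightarrow> real \<Rightarrow> (real \<Rightarrow> 'a::euclidean_space) set" where
  "W1p D p = {y \<in> Lp D p. \<exists>g \<in> Lp D p. has_weak_deriv D y g}"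

text \<open>
  On the interval \<open>(0,T)\<close> we always take the representative that is continuous on \<open>[0,T]\<close>, so that
  the values at \<open>0\<close> and \<open>T\<close> make sense.
\<close>
definition W1 :: "real \<Rightarrow> real \<Rightarrow> (real \<Rightarrow> 'a::euclidean_space) set" where
  "W1 T p = {y \<in> W1p {0<..<T} p. continuous_on {0..T} y}"

definition W10 :: "real \<Rightarrow> real \<Rightarrow> (real \<Rightarrow> 'a::euclidean_space) set" where
  "W10 T p = {y \<in> W1 T p. y 0 = 0}"

abbreviation H1 :: "real \<Rightarrow> (real \<Rightarrow> 'a::euclidean_space) set" where
  "H1 T \<equiv> W1 T 2"

abbreviation H10 :: "real \<Rightarrow> (real \<Rightarrow> 'a::euclidean_space) set" where
  "H10 T \<equiv> W10 T 2"

abbreviation L2 :: "real \<Rightarrow> (real \<Rightarrow> 'a::euclidean_space) set" where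
  "L2 T \<equiv> Lp {0<..<T} 2"

abbreviation time_deriv :: "real \<Rightarrow> (real \<Rightarrow> 'a::euclidean_space) \<Rightarrow> (real \<Rightarrow> 'a)" where
  "time_deriv T \<equiv> weak_deriv {0<..<T}"

definition H1_inner :: "real \<Rightarrow> (real \<Rightarrow> 'a::euclidean_space) \<Rightarrow> (real \<Rightarrow> 'a) \<Rightarrow> real" where
  "H1_inner T u v =
     L2_inner {0<..<T} u v + L2_inner {0<..<T} (time_deriv T u) (time_deriv T v)"

definition H1_norm :: "real \<Rightarrow> (real \<Rightarrow> 'a::euclidean_space) \<Rightarrow> real" where
  "H1_norm T u = sqrt (H1_inner T u u)"

definition W11_norm :: "real \<Rightarrow> (real \<Rightarrow> 'a::euclidean_space) \<Rightarrow> real" where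
  "W11_norm T u = Lp_norm {0<..<T} 1 u + Lp_norm {0<..<T} 1 (time_deriv T u)"

text \<open>The norm of the dual of \<open>W10 T 1\<close>; extended real, so that unbounded functionals have norm \<open>\<infinity>\<close>.\<close>
definition Wm1inf_norm :: "real \<Rightarrow> ((real \<Rightarrow> 'a::euclidean_space) \<Rightarrow> real) \<Rightarrow> ereal" where
  "Wm1inf_norm T F = (SUP v \<in> {v \<in> W10 T 1. W11_norm T v \<le> 1}. ereal \<bar>F v\<bar>)"

definition as_functional ::
  "real \<Rightarrow> (real \<Rightarrow> 'a::euclidean_space) \<Rightarrow> (real \<Rightarrow> 'a) \<Rightarrow> real" where
  "as_functional T l v = (LINT t|lebesgue_on {0<..<T}. l t \<bullet> v t)"

text \<open>
  Frechet differentiability on \<open>L\<^sup>2(0,T)\<close> with continuous derivative, the derivative at \<open>q\<close> being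
  represented by \<open>dj q\<close> in \<open>L\<^sup>2(0,T)\<close>. The case of a null increment \<open>h\<close> shows that \<open>j\<close> only depends
  on the almost-everywhere class of its argument.
\<close>
definition L2_C1 ::
  "real \<Rightarrow> ((real \<Rightarrow> 'a::euclidean_space) \<Rightarrow> real) \<Rightarrow> ((real \<Rightarrow> 'a) \<Rightarrow> (real \<Rightarrow> 'a)) \<Rightarrow> bool" where
  "L2_C1 T j dj \<longleftrightarrow>
     (\<forall>q \<in> L2 T. dj q \<in> L2 T) \<and>
     (\<forall>q \<in> L2 T. \<forall>e>0. \<exists>d>0. \<forall>h \<in> L2 T. Lp_norm {0<..<T} 2 h < d \<longrightarrow>
        \<bar>j (\<lambda>t. q t + h t) - j q - L2_inner {0<..<T} (dj q) h\<bar> \<le> e * Lp_norm {0<..<T} 2 h) \<and>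
     (\<forall>q \<in> L2 T. \<forall>e>0. \<exists>d>0. \<forall>p \<in> L2 T. Lp_norm {0<..<T} 2 (\<lambda>t. p t - q t) < d \<longrightarrow>
        Lp_norm {0<..<T} 2 (\<lambda>t. dj p t - dj q t) < e)"

text \<open>For a bounded linear \<open>A\<close> on \<open>L\<^sup>2(0,T)\<close> each value of the adjoint is unique almost everywhere.\<close>
definition L2_adjoint ::
  "real \<Rightarrow> ((real \<Rightarrow> 'a::euclidean_space) \<Rightarrow> (real \<Rightarrow> 'a)) \<Rightarrow> ((real \<Rightarrow> 'a) \<Rightarrow> (real \<Rightarrow> 'a))" where
  "L2_adjoint T A = (SOME B. \<forall>w \<in> L2 T. B w \<in> L2 T \<and>
      (\<forall>v \<in> L2 T. L2_inner {0<..<T} (A v) w = L2_inner {0<..<T} v (B w)))"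

section \<open>State equations\<close>

definition hist :: "real ^ 'n \<Rightarrow> (real \<Rightarrow> real ^ 'n) \<Rightarrow> real \<Rightarrow> real ^ 'n" where
  "hist y0 y t = (LINT s|lebesgue_on {0..t}. y s) + y0"

definition cw :: "(real \<Rightarrow> real) \<Rightarrow> real ^ 'n \<Rightarrow> real ^ 'n" where
  "cw f x = (\<chi> i. f (x $ i))"

definition kappa_hist_deriv ::
  "(real \<Rightarrow> real) \<Rightarrow> real ^ 'n \<Rightarrow> (real \<Rightarrow> real ^ 'n) \<Rightarrow> (real \<Rightarrow> real ^ 'n) \<Rightarrow> real \<Rightarrow> real ^ 'n" where
  "kappa_hist_deriv \<kappa> y0 q v t =
     (\<chi> i. deriv \<kappa> (hist y0 q t $ i) * (LINT s|lebesgue_on {0..t}. v s) $ i)"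

definition nonneg_cone :: "(real ^ 'n) set" where
  "nonneg_cone = {\<eta>. \<forall>i. 0 \<le> \<eta> $ i}"

definition dissip :: "(real \<Rightarrow> real) \<Rightarrow> real ^ 'n \<Rightarrow> real ^ 'n \<Rightarrow> ereal" where
  "dissip \<kappa> \<zeta> \<eta> = (if \<eta> \<in> nonneg_cone then ereal (cw \<kappa> \<zeta> \<bullet> \<eta>) else \<infinity>)"

definition dissip_eps :: "(real \<Rightarrow> real) \<Rightarrow> real \<Rightarrow> real ^ 'n \<Rightarrow> real ^ 'n \<Rightarrow> ereal" where
  "dissip_eps \<kappa> e \<zeta> \<eta> =
     (if \<eta> \<in> nonneg_cone then ereal (cw \<kappa> \<zeta> \<bullet> \<eta> + e / 2 * (norm \<eta>)\<^sup>2) else \<infinity>)"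

text \<open>For proper \<open>f\<close> this is empty wherever \<open>f x = \<infinity>\<close>, as usual.\<close>
definition subdifferential :: "('a::real_inner \<Rightarrow> ereal) \<Rightarrow> 'a \<Rightarrow> 'a set" where
  "subdifferential f x = {g. \<forall>w. f x + ereal (g \<bullet> (w - x)) \<le> f w}"

text \<open>\<open>q\<close> solves the evolution inclusion driven by \<open>l\<close> with dissipation \<open>D \<zeta> \<eta>\<close>.\<close>
definition solves ::
  "real \<Rightarrow> real \<Rightarrow> real ^ 'n \<Rightarrow> (real ^ 'n \<Rightarrow> real ^ 'n \<Rightarrow> ereal) \<Rightarrow>
   (real \<Rightarrow> real ^ 'n) \<Rightarrow> (real \<Rightarrow> real ^ 'n) \<Rightarrow> bool" where
  "solves T \<alpha> y0 D l q \<longleftrightarrow> q \<in> H10 T \<and>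
     (AE t in lebesgue_on {0<..<T}.
        - \<alpha> *\<^sub>R q t + l t \<in> subdifferential (D (hist y0 q t)) (time_deriv T q t))"

definition uniquely_solvable ::
  "real \<Rightarrow> real \<Rightarrow> real ^ 'n \<Rightarrow> (real ^ 'n \<Rightarrow> real ^ 'n \<Rightarrow> ereal) \<Rightarrow>
   (real \<Rightarrow> real ^ 'n) \<Rightarrow> bool" where
  "uniquely_solvable T \<alpha> y0 D l \<longleftrightarrow>
     (\<exists>q. solves T \<alpha> y0 D l q) \<and>
     (\<forall>q p. solves T \<alpha> y0 D l q \<longrightarrow> solves T \<alpha> y0 D l p \<longrightarrow> (\<forall>t \<in> {0..T}. q t = p t))"

text \<open>The solution is determined on \<open>[0,T]\<close> only, hence \<open>SOME\<close> rather than \<open>THE\<close>.\<close>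
definition state :: "real \<Rightarrow> real \<Rightarrow> (real \<Rightarrow> real) \<Rightarrow> real ^ 'n \<Rightarrow>
    (real \<Rightarrow> real ^ 'n) \<Rightarrow> (real \<Rightarrow> real ^ 'n)" where
  "state T \<alpha> \<kappa> y0 l = (SOME q. solves T \<alpha> y0 (dissip \<kappa>) l q)"

definition state_eps :: "real \<Rightarrow> real \<Rightarrow> (real \<Rightarrow> real) \<Rightarrow> real ^ 'n \<Rightarrow> real \<Rightarrow>
    (real \<Rightarrow> real ^ 'n) \<Rightarrow> (real \<Rightarrow> real ^ 'n)" where
  "state_eps T \<alpha> \<kappa> y0 e l = (SOME q. solves T \<alpha> y0 (dissip_eps \<kappa> e) l q)"

section \<open>Control problems\<close>

definition cost :: "real \<Rightarrow> real \<Rightarrow> (real \<Rightarrow> real) \<Rightarrow> real ^ 'n \<Rightarrow>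
    ((real \<Rightarrow> real ^ 'n) \<Rightarrow> real) \<Rightarrow> real ^ 'n \<Rightarrow> (real \<Rightarrow> real ^ 'n) \<Rightarrow> real" where
  "cost T \<alpha> \<kappa> y0 j qd l =
     j (state T \<alpha> \<kappa> y0 l) + 1 / 2 * (norm (state T \<alpha> \<kappa> y0 l T - qd))\<^sup>2
     + 1 / 2 * (H1_norm T l)\<^sup>2"

definition cost_eps :: "real \<Rightarrow> real \<Rightarrow> (real \<Rightarrow> real) \<Rightarrow> real ^ 'n \<Rightarrow>
    ((real \<Rightarrow> real ^ 'n) \<Rightarrow> real) \<Rightarrow> real ^ 'n \<Rightarrow> (real \<Rightarrow> real ^ 'n) \<Rightarrow> real \<Rightarrow>
    (real \<Rightarrow> real ^ 'n) \<Rightarrow> real" where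
  "cost_eps T \<alpha> \<kappa> y0 j qd lbar e l =
     j (state_eps T \<alpha> \<kappa> y0 e l) + 1 / 2 * (norm (state_eps T \<alpha> \<kappa> y0 e l T - qd))\<^sup>2
     + 1 / 2 * (H1_norm T l)\<^sup>2 + 1 / 2 * (H1_norm T (\<lambda>t. l t - lbar t))\<^sup>2"

definition local_min ::
  "real \<Rightarrow> ((real \<Rightarrow> 'a::euclidean_space) \<Rightarrow> real) \<Rightarrow> (real \<Rightarrow> 'a) \<Rightarrow> bool" where
  "local_min T J l \<longleftrightarrow> l \<in> H10 T \<and>
     (\<exists>r>0. \<forall>m \<in> H10 T. H1_norm T (\<lambda>t. m t - l t) < r \<longrightarrow> J l \<le> J m)"

section \<open>Optimality system of the regularized problems\<close>

definition adjoint_system :: "real \<Rightarrow> real \<Rightarrow> (real \<Rightarrow> real) \<Rightarrow> real ^ 'n \<Rightarrow>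
    ((real \<Rightarrow> real ^ 'n) \<Rightarrow> (real \<Rightarrow> real ^ 'n)) \<Rightarrow> real ^ 'n \<Rightarrow> (real \<Rightarrow> real ^ 'n) \<Rightarrow> real \<Rightarrow>
    (real \<Rightarrow> real ^ 'n) \<Rightarrow> (real \<Rightarrow> real ^ 'n) \<Rightarrow> (real \<Rightarrow> real ^ 'n) \<Rightarrow> bool" where
  "adjoint_system T \<alpha> \<kappa> y0 dj qd lbar e l xi lam \<longleftrightarrow>
     (let q = state_eps T \<alpha> \<kappa> y0 e l;
          z = (\<lambda>t. - \<alpha> *\<^sub>R q t + l t - cw \<kappa> (hist y0 q t))
      in xi \<in> H1 T \<and> lam \<in> Linf {0<..<T} \<and>
         (AE t in lebesgue_on {0<..<T}.
            - time_deriv T xi t + \<alpha> *\<^sub>R lam t + L2_adjoint T (kappa_hist_deriv \<kappa> y0 q) lam t = dj q t) \<and>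
         xi T = q T - qd \<and>
         (\<forall>i. AE t in lebesgue_on {0<..<T}.
            (z t $ i \<noteq> 0 \<longrightarrow> lam t $ i = 1 / e * indicator {s. z s $ i > 0} t * xi t $ i) \<and>
            (z t $ i = 0 \<longrightarrow> 0 \<le> lam t $ i \<and> lam t $ i \<le> 1 / e * xi t $ i)) \<and>
         (\<forall>v \<in> H10 T. as_functional T lam v + H1_inner T l v + H1_inner T (\<lambda>t. l t - lbar t) v = 0))"

end

(*
  The multiplier has the sign of the adjoint state and vanishes where the latter does, so testing the
  adjoint equation with sgn xi turns alpha * lam into alpha * |lam|. Together with the Volterra form
  of the adjoint of (kappa o H)' and a backward Gronwall argument this bounds lam in L1 and xi in
  L-infinity by |xi(T)| and the L2 norm of j'(q). The W(-1,infinity) bound for lam follows from the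
  embedding of W(1,1) into L-infinity.

  The states are bounded and componentwise nondecreasing, since alpha * q <= l wherever q grows. By
  Helly's theorem they are relatively compact in L2, so the continuous map j' is bounded on them.
*)
theory Submission
  imports Defs
begin

section \<open>Weak derivatives on an interval\<close>

text \<open>The sign condition is used in the form \<open>lam * xi >= 0\<close> and
  \<open>|lam| <= |xi| / eps\<close>, componentwise. The second part degenerates as eps tends to 0,
  but its constant decides only how far to the right of a zero of \<open>xi\<close> a local argument
  reaches; it enters no bound, which is why the estimates are uniform in eps. The bound on j'(q) is
  the other obstacle: a continuous map on \<open>L2\<close> may be unbounded on bounded sets, and
  the state equation, read directly, bounds the time derivative of q with a factor 1/eps.
  Monotonicity gives a variation bound free of eps instead. The bound on q itself comes from the
  loads, which are bounded in H1 because they converge. Sobolev membership is stated through test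
  functions, and \<open>weak_deriv\<close> and \<open>L2_adjoint\<close> are arbitrary choices.
  Pointwise information must therefore be recovered beforehand: the fundamental theorem for the
  continuous representative, uniqueness of the derivative up to null sets, and the explicit form of
  the adjoint.\<close>

definition smoothstep :: "real \<Rightarrow> real" where
  "smoothstep x = 2 * ((max 0 x)\<^sup>2 - 2 * (max 0 (x - 1/2))\<^sup>2 + (max 0 (x - 1))\<^sup>2)"

text \<open>A tent on [0,1] with peak 2 and mass one; \<open>smoothstep\<close> is its primitive, a
  quadratic spline climbing from 0 to 1. Test functions are only asked to be C1, so this spline is
  smooth enough for a cut-off.\<close>

definition smoothstep' :: "real \<Rightarrow> real" where
  "smoothstep' x = 4 * (max 0 x - 2 * max 0 (x - 1/2) + max 0 (x - 1))"

lemma DERIV_max_0_squared: "((\<lambda>x. (max 0 x)\<^sup>2) has_real_derivative 2 * max 0 x) (at (x::real))"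
proof (cases x "0::real" rule: linorder_cases)
  case less
  have "((\<lambda>x. 0) has_real_derivative 2 * max 0 x) (at x)"
    using less by (auto intro!: derivative_eq_intros)
  then show ?thesis
    by (rule has_field_derivative_transform_within_open[where S="{..<0}"]) (use less in auto)
next
  case equal
  have "((\<lambda>h. ((max 0 h)\<^sup>2 - (max 0 0)\<^sup>2) / h) \<longlongrightarrow> 0) (at (0::real))"
  proof (rule Lim_null_comparison)
    show "\<forall>\<^sub>F h in at (0::real). norm (((max 0 h)\<^sup>2 - (max 0 0)\<^sup>2) / h) \<le> \<bar>h\<bar>"
      by (auto simp: max_def power2_eq_square)
    show "((\<lambda>h. \<bar>h\<bar>) \<longlongrightarrow> 0) (at (0::real))"
      by (auto intro!: tendsto_eq_intros)
  qed
  then show ?thesis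
    by (simp add: equal DERIV_def)
next
  case greater
  have "((\<lambda>x. x\<^sup>2) has_real_derivative 2 * max 0 x) (at x)"
    using greater by (auto intro!: derivative_eq_intros)
  then show ?thesis
    by (rule has_field_derivative_transform_within_open[where S="{0<..}"]) (use greater in auto)
qed

lemma DERIV_smoothstep: "(smoothstep has_real_derivative smoothstep' x) (at x)"
proof -
  have "((\<lambda>x. (max 0 (x - c))\<^sup>2) has_real_derivative 2 * max 0 (x - c)) (at x)" for c
  proof -
    have "((\<lambda>x. x - c) has_real_derivative 1) (at x)"
      by (auto intro!: derivative_eq_intros)
    from DERIV_chain2[OF DERIV_max_0_squared this] show ?thesis by simp
  qed
  note this[derivative_intros] DERIV_max_0_squared[derivative_intros]
  show ?thesis
    unfolding smoothstep_def[abs_def] smoothstep'_def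
    by (auto intro!: derivative_eq_intros)
qed

lemma smoothstep_le_0: "x \<le> 0 \<Longrightarrow> smoothstep x = 0"
  by (simp add: smoothstep_def)

lemma smoothstep_ge_1: "1 \<le> x \<Longrightarrow> smoothstep x = 1"
  by (simp add: smoothstep_def max_def power2_eq_square algebra_simps)

lemma smoothstep'_nonneg: "0 \<le> smoothstep' x"
  by (simp add: smoothstep'_def max_def)

lemma smoothstep'_eq_0: "x \<le> 0 \<or> 1 \<le> x \<Longrightarrow> smoothstep' x = 0"
  by (auto simp add: smoothstep'_def max_def)

lemma continuous_smoothstep': "continuous_on S (\<lambda>x. smoothstep' (c * (x - d)))"
  unfolding smoothstep'_def by (intro continuous_intros)

lemma smoothstep_bounds: "0 \<le> smoothstep x" "smoothstep x \<le> 1"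
proof -
  have mono: "smoothstep u \<le> smoothstep v" if "u \<le> v" for u v
    using DERIV_nonneg_imp_nondecreasing[OF that, of smoothstep] DERIV_smoothstep smoothstep'_nonneg
    by blast
  show "0 \<le> smoothstep x"
    using mono[of "min 0 x" x] by (simp add: smoothstep_le_0)
  show "smoothstep x \<le> 1"
    using mono[of x "max 1 x"] by (simp add: smoothstep_ge_1)
qed

lemma DERIV_smoothstep_scaled:
  "((\<lambda>t. smoothstep (r * (t - a))) has_real_derivative r * smoothstep' (r * (t - a))) (at t)"
proof -
  have "((\<lambda>t. r * (t - a)) has_real_derivative r) (at t)"
    by (auto intro!: derivative_eq_intros)
  from DERIV_chain2[OF DERIV_smoothstep this] show ?thesis by (simp add: mult.commute)
qed

text \<open>The rescaled tent is an approximate identity with unit mass on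
  \<open>[a, a + 1/n]\<close>. It lies entirely to the right of \<open>a\<close>, so continuity
  within the interval determines the limit.\<close>

lemma smoothstep_average_tendsto:
  fixes y :: "real \<Rightarrow> 'a::euclidean_space"
  assumes "a < c" and y: "continuous_on {a..c} y"
  shows "(\<lambda>n. integral {a..c} (\<lambda>t. (real n * smoothstep' (real n * (t - a))) *\<^sub>R y t)) \<longlonglongrightarrow> y a"
proof (rule LIMSEQ_I)
  fix e :: real assume "0 < e"
  obtain d where d: "0 < d" "\<And>t. t \<in> {a..c} \<Longrightarrow> dist t a < d \<Longrightarrow> dist (y t) (y a) < e / 2"
    using y[unfolded continuous_on_iff, rule_format, of a "e / 2"] \<open>a < c\<close> \<open>0 < e\<close> by auto
  \<comment> \<open>\<open>N\<close> shrinks the support \<open>[a, a + 1/n]\<close> into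
    \<open>[a,c]\<close>, which then carries the full mass, and into the
    \<open>d\<close>-neighbourhood of \<open>a\<close>.\<close>
  obtain N :: nat where N: "1 / min d (c - a) < real N"
    using reals_Archimedean2 by blast
  show "\<exists>N. \<forall>n\<ge>N. norm (integral {a..c} (\<lambda>t. (real n * smoothstep' (real n * (t - a))) *\<^sub>R y t) - y a) < e"
  proof (intro exI allI impI)
    fix n assume "N \<le> n"
    with N have n: "1 / min d (c - a) < real n" by linarith
    have pos: "0 < min d (c - a)" using d \<open>a < c\<close> by auto
    have n0: "0 < real n" using less_trans[OF divide_pos_pos[OF zero_less_one pos] n] .
    have n1: "1 < real n * min d (c - a)" using n pos by (simp add: pos_divide_less_eq)
    let ?\<rho> = "\<lambda>t. real n * smoothstep' (real n * (t - a))"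
    have I: "(?\<rho> has_integral (smoothstep (real n * (c - a)) - smoothstep (real n * (a - a)))) {a..c}"
      by (rule fundamental_theorem_of_calculus)
        (use \<open>a < c\<close> in \<open>auto intro!: has_field_derivative_at_within DERIV_smoothstep_scaled
            simp flip: has_real_derivative_iff_has_vector_derivative\<close>)
    have "1 \<le> real n * (c - a)"
      using n1 mult_left_mono[of "min d (c - a)" "c - a" "real n"] by simp
    then have I1: "(?\<rho> has_integral 1) {a..c}"
      using I by (simp add: smoothstep_ge_1 smoothstep_le_0)
    have 1: "integral {a..c} (\<lambda>t. ?\<rho> t *\<^sub>R y t) - y a = integral {a..c} (\<lambda>t. ?\<rho> t *\<^sub>R (y t - y a))"
    proof -
      have "integral {a..c} (\<lambda>t. ?\<rho> t *\<^sub>R y a) = y a"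
        using has_integral_scaleR_left[OF I1, of "y a"] by (simp add: integral_unique)
      moreover have "integral {a..c} (\<lambda>t. ?\<rho> t *\<^sub>R y t - ?\<rho> t *\<^sub>R y a) =
          integral {a..c} (\<lambda>t. ?\<rho> t *\<^sub>R y t) - integral {a..c} (\<lambda>t. ?\<rho> t *\<^sub>R y a)"
        by (intro Henstock_Kurzweil_Integration.integral_diff integrable_continuous_real continuous_intros continuous_smoothstep' y)
      ultimately show ?thesis by (simp add: scaleR_diff_right)
    qed
    have "norm (integral {a..c} (\<lambda>t. ?\<rho> t *\<^sub>R (y t - y a))) \<le> integral {a..c} (\<lambda>t. ?\<rho> t * (e / 2))"
    proof (rule integral_norm_bound_integral)
      show "(\<lambda>t. ?\<rho> t *\<^sub>R (y t - y a)) integrable_on {a..c}"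
        by (intro integrable_continuous_real continuous_intros continuous_smoothstep' y)
      show "(\<lambda>t. ?\<rho> t * (e / 2)) integrable_on {a..c}"
        by (intro integrable_continuous_real continuous_intros continuous_smoothstep')
      fix t assume t: "t \<in> {a..c}"
      show "norm (?\<rho> t *\<^sub>R (y t - y a)) \<le> ?\<rho> t * (e / 2)"
      proof (cases "dist t a < d")
        case True
        then show ?thesis
          using d(2)[OF t True] n0 smoothstep'_nonneg[of "real n * (t - a)"]
          by (simp add: dist_norm abs_mult mult_left_mono)
      next
        case False
        have "1 < real n * d" using n1 mult_left_mono[of "min d (c - a)" d "real n"] by simp
        also have "\<dots> \<le> real n * (t - a)"
          using False t n0 by (intro mult_left_mono) (auto simp: dist_real_def)
        finally show ?thesis by (simp add: smoothstep'_eq_0)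
      qed
    qed
    also have "\<dots> = e / 2"
      using integral_unique[OF has_integral_mult_left[OF I1, of "e/2"]] by simp
    finally show "norm (integral {a..c} (\<lambda>t. ?\<rho> t *\<^sub>R y t) - y a) < e"
      unfolding 1 using \<open>0 < e\<close> by linarith
  qed
qed

section \<open>Passage between Bochner and gauge integrals on intervals\<close>

lemma lebesgue_on_zero_off:
  fixes f :: "'a::euclidean_space \<Rightarrow> 'b::euclidean_space"
  assumes "\<And>t. t \<notin> S \<Longrightarrow> f t = 0" "S \<subseteq> D" "S \<in> sets lebesgue" "D \<in> sets lebesgue"
  shows "integrable (lebesgue_on D) f \<longleftrightarrow> integrable (lebesgue_on S) f"
    and "integral\<^sup>L (lebesgue_on D) f = integral\<^sup>L (lebesgue_on S) f"
proof -
  have f: "(\<lambda>t. indicat_real D t *\<^sub>R f t) = (\<lambda>t. indicat_real S t *\<^sub>R f t)"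
    using assms by (auto simp: indicator_def fun_eq_iff)
  show "integrable (lebesgue_on D) f \<longleftrightarrow> integrable (lebesgue_on S) f"
    using assms f by (simp add: integrable_restrict_space)
  show "integral\<^sup>L (lebesgue_on D) f = integral\<^sup>L (lebesgue_on S) f"
    using assms f by (simp add: integral_restrict_space)
qed

lemma integrable_lebesgue_on_iff:
  fixes f :: "'a::euclidean_space \<Rightarrow> 'b::euclidean_space"
  assumes "S \<in> sets lebesgue"
  shows "integrable (lebesgue_on S) f \<longleftrightarrow> f absolutely_integrable_on S"
  using assms by (simp add: integrable_restrict_space set_integrable_def)

lemma integrable_Ioo_iff_absolutely_integrable_Icc:
  fixes f :: "real \<Rightarrow> 'a::euclidean_space"
  shows "integrable (lebesgue_on {a<..<b}) f \<longleftrightarrow> f absolutely_integrable_on {a..b}"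
  by (simp add: integrable_lebesgue_on_iff absolutely_integrable_on_Icc_iff_Ioo)

lemma LINT_Ioo_eq_integral:
  fixes f :: "real \<Rightarrow> 'a::euclidean_space"
  assumes "f absolutely_integrable_on {a..b}"
  shows "(LINT t|lebesgue_on {a<..<b}. f t) = integral {a..b} f"
proof -
  have "integrable (lebesgue_on {a<..<b}) f"
    using assms by (simp add: integrable_Ioo_iff_absolutely_integrable_Icc)
  then have "(LINT t|lebesgue_on {a<..<b}. f t) = integral {a<..<b} f"
    by (rule lebesgue_integral_eq_integral) auto
  then show ?thesis by (simp add: integral_open_interval_real)
qed

text \<open>The test functions \<open>\<phi> n\<close> rise just right of \<open>a\<close> and fall
  just right of \<open>b\<close>. Their derivatives are differences of two approximate identities,
  so one side of the weak formulation tends to \<open>y a - y b\<close>; the other tends to minus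
  the integral of \<open>g\<close> by dominated convergence. Continuity of \<open>y\<close> turns
  the averages into point values.\<close>

lemma weak_deriv_FTC:
  fixes y g :: "real \<Rightarrow> 'a::euclidean_space"
  assumes wd: "has_weak_deriv {u<..<v} y g" and y: "continuous_on {u<..<v} y"
    and ab: "u < a" "a \<le> b" "b < v"
  shows "y b - y a = integral {a..b} g"
proof -
  \<comment> \<open>The downward ramp occupies \<open>[b, b + 1/n]\<close>; \<open>c\<close> leaves
    it room to the right of \<open>b\<close> and keeps the support compact in
    \<open>(u,v)\<close>.\<close>
  define c where "c = (b + v) / 2"
  have c: "b < c" "c < v" using ab by (auto simp: c_def)
  define \<phi> where "\<phi> n t = smoothstep (real n * (t - a)) - smoothstep (real n * (t - b))" for n t
  define \<rho> where "\<rho> n x t = real n * smoothstep' (real n * (t - x))" for n x t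
  have sub: "{x..c} \<subseteq> {u<..<v}" if "a \<le> x" for x using ab c that by auto
  have yc: "continuous_on {x..c} y" if "a \<le> x" for x
    using y sub[OF that] continuous_on_subset by blast
  have gi: "integrable (lebesgue_on {a..c}) g"
    using wd sub[of a] unfolding has_weak_deriv_def locally_integrable_def by auto
  have [simp]: "{u<..<v} \<in> sets lebesgue" "{x..c} \<in> sets lebesgue" for x by auto
  \<comment> \<open>From this index on both ramps end before \<open>c\<close>, so
    \<open>\<phi> n\<close> is supported in \<open>[a,c]\<close>.\<close>
  obtain N :: nat where N: "1 / (c - b) < real N" using reals_Archimedean2 by blast
  have key: "integral {a..c} (\<lambda>t. \<rho> n a t *\<^sub>R y t) - integral {b..c} (\<lambda>t. \<rho> n b t *\<^sub>R y t)
      = - (LINT t|lebesgue_on {a..c}. \<phi> n t *\<^sub>R g t)" if "N \<le> n" for n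
  proof -
    have n: "1 / (c - b) < real n" using N that by linarith
    then have n0: "0 < real n" using c less_trans[OF divide_pos_pos[OF zero_less_one] n] by simp
    have n1: "1 < real n * (c - b)" using n c by (simp add: pos_divide_less_eq)
    have \<rho>0: "\<rho> n x t = 0" if "a \<le> x" "x \<le> b" "t \<notin> {x..c}" for x t
    proof -
      have "t \<le> x \<or> c \<le> t" using that by auto
      then have "real n * (t - x) \<le> 0 \<or> 1 \<le> real n * (t - x)"
      proof
        assume "c \<le> t"
        then have "real n * (c - b) \<le> real n * (t - x)" using that n0 by (intro mult_left_mono) auto
        then show ?thesis using n1 by linarith
      qed (use n0 in \<open>auto simp: mult_le_0_iff\<close>)
      then show ?thesis by (simp add: \<rho>_def smoothstep'_eq_0)
    qed
    have \<phi>0: "\<phi> n t = 0" if "t \<notin> {a..c}" for t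
    proof -
      have "t < a \<or> c < t" using that by auto
      then show ?thesis
      proof
        assume "t < a"
        then have "real n * (t - a) \<le> 0" "real n * (t - b) \<le> 0" using n0 ab by (auto simp: mult_le_0_iff)
        then show ?thesis by (simp add: \<phi>_def smoothstep_le_0)
      next
        assume "c < t"
        then have "real n * (c - b) \<le> real n * (t - b)" "real n * (c - b) \<le> real n * (t - a)"
          using n0 ab by (auto intro!: mult_left_mono)
        then show ?thesis using n1 by (simp add: \<phi>_def smoothstep_ge_1)
      qed
    qed
    have "test_function {u<..<v} (\<phi> n) (\<lambda>t. \<rho> n a t - \<rho> n b t)"
      unfolding test_function_def
    proof (intro conjI allI exI)
      show "(\<phi> n has_real_derivative \<rho> n a t - \<rho> n b t) (at t)" for t
        unfolding \<phi>_def \<rho>_def by (intro derivative_intros DERIV_smoothstep_scaled)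
      show "continuous_on UNIV (\<lambda>t. \<rho> n a t - \<rho> n b t)"
        unfolding \<rho>_def by (intro continuous_intros continuous_smoothstep')
      show "compact {a..c}" by simp
      show "{a..c} \<subseteq> {u<..<v}" using sub by auto
      show "t \<notin> {a..c} \<longrightarrow> \<phi> n t = 0" for t using \<phi>0 by auto
    qed
    then have eq: "(LINT t|lebesgue_on {u<..<v}. (\<rho> n a t - \<rho> n b t) *\<^sub>R y t) = - (LINT t|lebesgue_on {u<..<v}. \<phi> n t *\<^sub>R g t)"
      using wd unfolding has_weak_deriv_def by blast
    have int: "integrable (lebesgue_on {x..c}) (\<lambda>t. \<rho> n x t *\<^sub>R y t)" if "a \<le> x" for x
      unfolding \<rho>_def
      by (intro continuous_imp_integrable_real continuous_intros continuous_smoothstep' yc that)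
    have 1: "integrable (lebesgue_on {u<..<v}) (\<lambda>t. \<rho> n x t *\<^sub>R y t)"
      "(LINT t|lebesgue_on {u<..<v}. \<rho> n x t *\<^sub>R y t) = integral {x..c} (\<lambda>t. \<rho> n x t *\<^sub>R y t)"
      if "a \<le> x" "x \<le> b" for x
    proof -
      have off: "\<rho> n x t *\<^sub>R y t = 0" if "t \<notin> {x..c}" for t
        using \<rho>0[OF \<open>a \<le> x\<close> \<open>x \<le> b\<close> that] by simp
      note zero_off = lebesgue_on_zero_off[of "{x..c}" "\<lambda>t. \<rho> n x t *\<^sub>R y t", OF off sub[OF that(1)]]
      show "integrable (lebesgue_on {u<..<v}) (\<lambda>t. \<rho> n x t *\<^sub>R y t)"
        using zero_off int[OF that(1)] by simp
      show "(LINT t|lebesgue_on {u<..<v}. \<rho> n x t *\<^sub>R y t) = integral {x..c} (\<lambda>t. \<rho> n x t *\<^sub>R y t)"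
        using zero_off lebesgue_integral_eq_integral[OF int[OF that(1)]] by simp
    qed
    have "(LINT t|lebesgue_on {u<..<v}. (\<rho> n a t - \<rho> n b t) *\<^sub>R y t)
        = (LINT t|lebesgue_on {u<..<v}. \<rho> n a t *\<^sub>R y t) - (LINT t|lebesgue_on {u<..<v}. \<rho> n b t *\<^sub>R y t)"
      unfolding scaleR_diff_left by (intro Bochner_Integration.integral_diff 1) (use ab in auto)
    moreover have "(LINT t|lebesgue_on {u<..<v}. \<phi> n t *\<^sub>R g t) = (LINT t|lebesgue_on {a..c}. \<phi> n t *\<^sub>R g t)"
      using lebesgue_on_zero_off(2)[of "{a..c}" "\<lambda>t. \<phi> n t *\<^sub>R g t" "{u<..<v}"] \<phi>0 sub[of a] by auto
    ultimately show ?thesis using eq 1(2)[of a] 1(2)[of b] ab by simp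
  qed
  have "(\<lambda>n. integral {a..c} (\<lambda>t. \<rho> n a t *\<^sub>R y t) - integral {b..c} (\<lambda>t. \<rho> n b t *\<^sub>R y t)) \<longlonglongrightarrow> y a - y b"
    unfolding \<rho>_def using ab c by (intro tendsto_diff smoothstep_average_tendsto yc) auto
  \<comment> \<open>Half-open because each ramp still vanishes at its own starting point: the limit
    is 0 at \<open>a\<close> and 1 at \<open>b\<close>.\<close>
  moreover have "(\<lambda>n. LINT t|lebesgue_on {a..c}. \<phi> n t *\<^sub>R g t)
      \<longlonglongrightarrow> (LINT t|lebesgue_on {a..c}. indicator {a<..b} t *\<^sub>R g t)"
  proof (rule integral_dominated_convergence)
    show "(\<lambda>t. indicat_real {a<..b} t *\<^sub>R g t) \<in> borel_measurable (lebesgue_on {a..c})"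
    proof (rule borel_measurable_scaleR)
      show "indicat_real {a<..b} \<in> borel_measurable (lebesgue_on {a..c})"
        by (intro measurable_restrict_space1 borel_measurable_indicator) auto
    qed (use gi in auto)
    show "(\<lambda>t. \<phi> n t *\<^sub>R g t) \<in> borel_measurable (lebesgue_on {a..c})" for n
    proof -
      have "continuous_on UNIV (\<phi> n)"
        unfolding \<phi>_def
        using DERIV_smoothstep_scaled by (intro continuous_intros DERIV_continuous_on) (auto intro: has_field_derivative_at_within)
      then have "\<phi> n \<in> borel_measurable borel" by (rule borel_measurable_continuous_onI)
      then have "\<phi> n \<in> borel_measurable (lebesgue_on {a..c})"
        by (intro measurable_restrict_space1 measurable_completion) auto
      then show ?thesis using gi by (intro borel_measurable_scaleR) auto
    qed
    show "integrable (lebesgue_on {a..c}) (\<lambda>t. norm (g t))" using gi by auto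
    show "AE t in lebesgue_on {a..c}. norm (\<phi> n t *\<^sub>R g t) \<le> norm (g t)" for n
    proof (rule AE_I2)
      fix t
      have "\<bar>\<phi> n t\<bar> \<le> 1"
        unfolding \<phi>_def using smoothstep_bounds[of "real n * (t - a)"] smoothstep_bounds[of "real n * (t - b)"] by linarith
      then show "norm (\<phi> n t *\<^sub>R g t) \<le> norm (g t)" by (simp add: mult_left_le_one_le)
    qed
    show "AE t in lebesgue_on {a..c}. (\<lambda>n. \<phi> n t *\<^sub>R g t) \<longlonglongrightarrow> indicat_real {a<..b} t *\<^sub>R g t"
    proof (intro AE_I2 tendsto_scaleR tendsto_const)
      fix t
      have lim: "(\<lambda>n. smoothstep (real n * (t - x))) \<longlonglongrightarrow> (if x < t then 1 else 0)" for x
      proof (cases "x < t")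
        case True
        then have "\<forall>\<^sub>F n in sequentially. 1 \<le> real n * (t - x)"
          by real_asymp
        then show ?thesis using True
          by (auto intro!: tendsto_eventually elim!: eventually_mono simp: smoothstep_ge_1)
      next
        case False
        then have "smoothstep (real n * (t - x)) = 0" for n
          by (intro smoothstep_le_0) (auto simp: mult_le_0_iff)
        then show ?thesis using False by auto
      qed
      have "indicat_real {a<..b} t = (if a < t then 1 else 0) - (if b < t then 1 else 0)"
        using ab by auto
      then show "(\<lambda>n. \<phi> n t) \<longlonglongrightarrow> indicat_real {a<..b} t"
        unfolding \<phi>_def by (simp only:) (intro tendsto_diff lim)
    qed
  qed
  moreover have "(LINT t|lebesgue_on {a..c}. indicator {a<..b} t *\<^sub>R g t) = integral {a..b} g"
  proof -
    have gb: "integrable (lebesgue_on {a..b}) g"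
      using integrable_subinterval[OF gi, of a b] c by auto
    have "(LINT t|lebesgue_on {a..c}. indicat_real {a<..b} t *\<^sub>R g t) = (LINT t|lebesgue_on {a<..b}. indicat_real {a<..b} t *\<^sub>R g t)"
      by (rule lebesgue_on_zero_off) (use ab c in auto)
    also have "\<dots> = (LINT t|lebesgue_on {a<..b}. g t)"
      by (intro Bochner_Integration.integral_cong) auto
    also have "\<dots> = integral {a<..b} g"
    proof (rule lebesgue_integral_eq_integral)
      show "integrable (lebesgue_on {a<..b}) g"
      proof -
        have "g absolutely_integrable_on {a..b}"
          using gb by (simp add: integrable_lebesgue_on_iff)
        then have "g absolutely_integrable_on {a<..b}"
          by (rule set_integrable_subset) auto
        then show ?thesis by (simp add: integrable_lebesgue_on_iff)
      qed
    qed auto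
    also have "\<dots> = integral {a..b} g"
      by (rule integral_spike_set; rule negligible_subset[of "{a}"]; auto)
    finally show ?thesis .
  qed
  ultimately have "(\<lambda>n. - (LINT t|lebesgue_on {a..c}. \<phi> n t *\<^sub>R g t)) \<longlonglongrightarrow> - integral {a..b} g"
    and *: "(\<lambda>n. integral {a..c} (\<lambda>t. \<rho> n a t *\<^sub>R y t) - integral {b..c} (\<lambda>t. \<rho> n b t *\<^sub>R y t)) \<longlonglongrightarrow> y a - y b"
    by (simp_all only: tendsto_minus)
  moreover have "\<forall>\<^sub>F n in sequentially. - (LINT t|lebesgue_on {a..c}. \<phi> n t *\<^sub>R g t) =
      integral {a..c} (\<lambda>t. \<rho> n a t *\<^sub>R y t) - integral {b..c} (\<lambda>t. \<rho> n b t *\<^sub>R y t)"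
    using key by (intro eventually_sequentiallyI[of N]) simp
  ultimately have "(\<lambda>n. integral {a..c} (\<lambda>t. \<rho> n a t *\<^sub>R y t) - integral {b..c} (\<lambda>t. \<rho> n b t *\<^sub>R y t)) \<longlonglongrightarrow> - integral {a..b} g"
    by (blast intro: Lim_transform_eventually)
  then have "y a - y b = - integral {a..b} g" using LIMSEQ_unique * by blast
  then show ?thesis by (simp add: algebra_simps)
qed

text \<open>Dynkin argument: the sets over which \<open>h\<close> integrates to zero are closed
  under complements and countable disjoint unions, and open intervals form an intersection-stable
  generator of the Borel sets. Bounded support turns the integral over the whole line into one over
  an interval, as the complement step requires.\<close>

lemma zero_interval_integrals_imp_AE_zero:
  fixes h :: "real \<Rightarrow> 'a::euclidean_space"
  assumes h: "integrable lebesgue h" and 0: "\<And>a b. (LINT t:{a<..<b}|lebesgue. h t) = 0"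
    and supp: "\<And>t. t \<notin> {u<..<v} \<Longrightarrow> h t = 0"
  shows "AE t in lebesgue. h t = 0"
proof -
  have hI: "set_integrable lebesgue A h" if "A \<in> sets lebesgue" for A
    unfolding set_integrable_def using h that by (rule integrable_mult_indicator[rotated])
  have UNIV0: "(LINT t:UNIV|lebesgue. h t) = 0"
  proof -
    have "(LINT t:UNIV|lebesgue. h t) = (LINT t:{u<..<v}|lebesgue. h t)"
      unfolding set_lebesgue_integral_def
      by (intro Bochner_Integration.integral_cong) (use supp in \<open>auto simp: indicator_def\<close>)
    then show ?thesis using 0 by simp
  qed
  have borel: "(LINT t:A|lebesgue. h t) = 0" if "A \<in> sets borel" for A
  proof -
    let ?G = "range (\<lambda>(a, b). {a<..<b::real})"
    have G: "sets borel = sigma_sets UNIV ?G"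
      by (subst borel_eq_box) (simp add: case_prod_beta' box_real(1))
    have "Int_stable ?G"
    proof (rule Int_stableI)
      fix A B assume "A \<in> ?G" "B \<in> ?G"
      then obtain a b c d where "A = {a<..<b}" "B = {c<..<d}" by auto
      then have "A \<inter> B = (\<lambda>(a, b). {a<..<b}) (max a c, min b d)" by auto
      then show "A \<inter> B \<in> ?G" by blast
    qed
    moreover have "?G \<subseteq> Pow UNIV" by simp
    moreover have "A \<in> sigma_sets UNIV ?G" using that G by simp
    ultimately show ?thesis
    proof (induction rule: sigma_sets_induct_disjoint)
      case (basic A) then show ?case using 0 by auto
    next
      case empty then show ?case by (simp add: set_lebesgue_integral_def)
    next
      case (compl A)
      then have A: "A \<in> sets lebesgue" using G by auto
      have "(LINT t:A \<union> (UNIV - A)|lebesgue. h t) = (LINT t:A|lebesgue. h t) + (LINT t:UNIV - A|lebesgue. h t)"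
        using A by (intro set_integral_Un hI) auto
      moreover have "A \<union> (UNIV - A) = UNIV" by auto
      ultimately show ?case using compl.IH UNIV0 by simp
    next
      case (union A)
      then have "A i \<in> sets borel" for i using G by (metis range_subsetD)
      then have A: "A i \<in> sets lebesgue" for i by simp
      have "(LINT t:(\<Union>i. A i)|lebesgue. h t) = (\<Sum>i. (LINT t:(A i)|lebesgue. h t))"
        using union.hyps(1) by (intro lebesgue_integral_countable_add hI sets.countable_UN')
          (auto simp: disjoint_family_on_def A)
      then show ?case using union by simp
    qed
  qed
  have lebesgue: "(LINT t:A|lebesgue. h t) = 0" if "A \<in> sets lebesgue" for A
  proof -
    from that obtain S N N' where A: "A = S \<union> N" "N \<subseteq> N'" "N' \<in> null_sets lborel" "S \<in> sets lborel"
      by (rule sets_completionE)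
    have "AE t in lebesgue. t \<notin> N'"
      using A(3) by (intro AE_completion AE_not_in)
    then have "AE t in lebesgue. indicat_real A t *\<^sub>R h t = indicat_real S t *\<^sub>R h t"
      by eventually_elim (use A in \<open>auto simp: indicator_def\<close>)
    then have "(LINT t:A|lebesgue. h t) = (LINT t:S|lebesgue. h t)"
      unfolding set_lebesgue_integral_def using A h that
      by (intro integral_cong_AE borel_measurable_scaleR borel_measurable_indicator) auto
    then show ?thesis using borel A(4) by simp
  qed
  interpret finite_measure "lebesgue_on {u<..<v}"
    by (rule finite_measure_lebesgue_on) auto
  have "AE t in lebesgue_on {u<..<v}. h t = 0"
  proof (rule density_zero)
    show "integrable (lebesgue_on {u<..<v}) h"
      using hI[of "{u<..<v}"] by (simp add: integrable_lebesgue_on_iff)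
    fix A assume "A \<in> sets (lebesgue_on {u<..<v})"
    then have A: "A \<in> sets lebesgue" "A \<subseteq> {u<..<v}"
      by (auto simp: sets_restrict_space_iff)
    have "(LINT t:A|lebesgue_on {u<..<v}. h t) = (LINT t:A|lebesgue. h t)"
      unfolding set_lebesgue_integral_def using A(2)
      by (subst integral_restrict_space)
        (auto intro!: Bochner_Integration.integral_cong simp: indicator_def)
    then show "(LINT t:A|lebesgue_on {u<..<v}. h t) = 0"
      using lebesgue[OF A(1)] by simp
  qed
  then have "AE t in lebesgue. t \<in> {u<..<v} \<longrightarrow> h t = 0"
    by (simp add: AE_restrict_space_iff)
  then show ?thesis
    by eventually_elim (use supp in blast)
qed

text \<open>By the fundamental theorem both derivatives have the same integral over every compact
  subinterval. Since \<open>weak_deriv\<close> is an arbitrary choice, this lets it inherit what is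
  known of any particular derivative.\<close>

lemma weak_deriv_AE_unique:
  fixes y g g' :: "real \<Rightarrow> 'a::euclidean_space"
  assumes g: "has_weak_deriv {u<..<v} y g" and g': "has_weak_deriv {u<..<v} y g'"
    and y: "continuous_on {u<..<v} y"
  shows "AE t in lebesgue_on {u<..<v}. g t = g' t"
proof -
  have loc: "AE t in lebesgue. t \<in> {a<..<b} \<longrightarrow> g t = g' t" if ab: "u < a" "a < b" "b < v" for a b
  proof -
    have ig: "g absolutely_integrable_on {a..b}" "g' absolutely_integrable_on {a..b}"
    proof -
      have "compact {a..b}" "{a..b} \<subseteq> {u<..<v}" using ab by auto
      then have "integrable (lebesgue_on {a..b}) g" "integrable (lebesgue_on {a..b}) g'"
        using g g' unfolding has_weak_deriv_def locally_integrable_def by blast+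
      then show "g absolutely_integrable_on {a..b}" "g' absolutely_integrable_on {a..b}"
        by (simp_all add: integrable_lebesgue_on_iff)
    qed
    have "(\<lambda>t. g t - g' t) absolutely_integrable_on {a..b}"
      using ig by (rule set_integral_diff)
    then have "(\<lambda>t. g t - g' t) absolutely_integrable_on {a<..<b}"
      by (rule set_integrable_subset) auto
    then have h: "integrable lebesgue (\<lambda>t. indicat_real {a<..<b} t *\<^sub>R (g t - g' t))"
      by (simp add: set_integrable_def)
    have "AE t in lebesgue. indicat_real {a<..<b} t *\<^sub>R (g t - g' t) = 0"
    proof (rule zero_interval_integrals_imp_AE_zero[OF h])
      fix c d
      show "(LINT t:{c<..<d}|lebesgue. indicat_real {a<..<b} t *\<^sub>R (g t - g' t)) = 0"
      proof (cases "max a c < min b d")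
        case True
        define p q where "p = max a c" and "q = min b d"
        have pq: "p < q" "a \<le> p" "q \<le> b" "{c<..<d} \<inter> {a<..<b} = {p<..<q}" "u < p" "q < v"
          using True ab by (auto simp: p_def q_def)
        have ai: "(\<lambda>t. g t - g' t) absolutely_integrable_on {p<..<q}"
          by (rule set_integrable_subset[OF \<open>(\<lambda>t. g t - g' t) absolutely_integrable_on {a<..<b}\<close>]) (use pq in auto)
        have gpq: "g integrable_on {p..q}" "g' integrable_on {p..q}"
          using ig pq by (auto intro: integrable_on_subinterval[OF set_lebesgue_integral_eq_integral(1)])
        have "(LINT t:{c<..<d}|lebesgue. indicat_real {a<..<b} t *\<^sub>R (g t - g' t)) = (LINT t:{p<..<q}|lebesgue. g t - g' t)"
          unfolding set_lebesgue_integral_def pq(4)[symmetric]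
          by (intro Bochner_Integration.integral_cong) (auto simp: indicator_def)
        also have "\<dots> = integral {p<..<q} (\<lambda>t. g t - g' t)"
          by (rule set_lebesgue_integral_eq_integral[OF ai])
        also have "\<dots> = integral {p..q} (\<lambda>t. g t - g' t)"
          by (rule integral_spike_set; rule negligible_subset[of "{p, q}"]; auto)
        also have "\<dots> = integral {p..q} g - integral {p..q} g'"
          by (intro Henstock_Kurzweil_Integration.integral_diff gpq)
        also have "\<dots> = 0"
          using weak_deriv_FTC[OF g y, of p q] weak_deriv_FTC[OF g' y, of p q] pq by simp
        finally show ?thesis .
      next
        case False
        then have "{c<..<d} \<inter> {a<..<b} = {}" by auto
        then have "indicat_real {c<..<d} t *\<^sub>R indicat_real {a<..<b} t *\<^sub>R (g t - g' t) = 0" for t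
          by (auto simp: indicator_def)
        then show ?thesis unfolding set_lebesgue_integral_def by (simp only: integral_zero)
      qed
    qed (auto simp: indicator_def)
    then show ?thesis by eventually_elim (auto simp: indicator_def)
  qed
  \<comment> \<open>Weak derivatives are integrable only on compact subsets, so \<open>(u,v)\<close>
    is exhausted by countably many smaller intervals.\<close>
  have "AE t in lebesgue. \<forall>n. t \<in> {u + 1 / real (Suc n)<..<v - 1 / real (Suc n)} \<longrightarrow> g t = g' t"
  proof (subst AE_all_countable, rule allI)
    fix n
    show "AE t in lebesgue. t \<in> {u + 1 / real (Suc n)<..<v - 1 / real (Suc n)} \<longrightarrow> g t = g' t"
    proof (cases "u + 1 / real (Suc n) < v - 1 / real (Suc n)")
      case True
      then show ?thesis by (intro loc) auto
    qed auto
  qed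
  then have "AE t in lebesgue. t \<in> {u<..<v} \<longrightarrow> g t = g' t"
  proof eventually_elim
    case (elim t)
    show ?case
    proof
      assume t: "t \<in> {u<..<v}"
      obtain n where "inverse (real (Suc n)) < min (t - u) (v - t)"
        using t reals_Archimedean[of "min (t - u) (v - t)"] by auto
      then have "t \<in> {u + 1 / real (Suc n)<..<v - 1 / real (Suc n)}"
        by (auto simp: inverse_eq_divide)
      with elim show "g t = g' t" by blast
    qed
  qed
  then show ?thesis by (simp add: AE_restrict_space_iff)
qed

section \<open>The chosen time derivative and pointwise bounds by Sobolev norms\<close>

lemma borel_measurable_lebesgue_on_AE:
  fixes f g :: "real \<Rightarrow> 'a::euclidean_space"
  assumes f: "f \<in> borel_measurable (lebesgue_on S)" and S: "S \<in> sets lebesgue"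
    and eq: "AE x in lebesgue_on S. f x = g x"
  shows "g \<in> borel_measurable (lebesgue_on S)"
proof -
  have "AE x in lebesgue. (if x \<in> S then f x else 0) = (if x \<in> S then g x else 0)"
    using eq S by (simp add: AE_restrict_space_iff)
  then show ?thesis
    by (rule borel_measurable_if_D[OF borel_measurable_AE[OF borel_measurable_if_I[OF f S]]])
qed

lemma finite_measure_lebesgue_on_Ioo: "finite_measure (lebesgue_on {a<..<b::real})"
  by (rule finite_measure_lebesgue_on) auto

lemma Lp_imp_integrable:
  fixes f :: "real \<Rightarrow> 'a::euclidean_space"
  assumes "f \<in> Lp {a<..<b} p" "1 \<le> p"
  shows "integrable (lebesgue_on {a<..<b}) f"
proof -
  interpret finite_measure "lebesgue_on {a<..<b}" by (rule finite_measure_lebesgue_on_Ioo)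
  have f: "f \<in> borel_measurable (lebesgue_on {a<..<b})"
    "integrable (lebesgue_on {a<..<b}) (\<lambda>t. norm (f t) powr p)"
    using assms by (auto simp: Lp_def)
  have "integrable (lebesgue_on {a<..<b}) (\<lambda>t. 1 + norm (f t) powr p)"
    using f by auto
  then show ?thesis
  proof (rule Bochner_Integration.integrable_bound)
    show "AE t in lebesgue_on {a<..<b}. norm (f t) \<le> norm (1 + norm (f t) powr p)"
    proof (rule AE_I2)
      fix t
      have "norm (f t) \<le> 1 + norm (f t) powr p"
      proof (cases "norm (f t) \<le> 1")
        case False
        then have "norm (f t) powr 1 \<le> norm (f t) powr p" using assms by (intro powr_mono) auto
        then show ?thesis using False by simp
      next
        case True
        then show ?thesis using powr_ge_zero[of "norm (f t)" p] by linarith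
      qed
      then show "norm (f t) \<le> norm (1 + norm (f t) powr p)" by simp
    qed
  qed (use f in auto)
qed

text \<open>Membership in \<open>W1\<close> promises some derivative in \<open>Lp\<close>;
  almost-everywhere uniqueness transfers measurability and integrability to the one picked by
  \<open>time_deriv\<close>.\<close>

lemma W1_time_deriv:
  fixes y :: "real \<Rightarrow> 'a::euclidean_space"
  assumes "y \<in> W1 T p"
  shows "has_weak_deriv {0<..<T} y (time_deriv T y)" "time_deriv T y \<in> Lp {0<..<T} p"
proof -
  obtain g where g: "g \<in> Lp {0<..<T} p" "has_weak_deriv {0<..<T} y g"
    using assms by (auto simp: W1_def W1p_def)
  show wd: "has_weak_deriv {0<..<T} y (time_deriv T y)"
    unfolding weak_deriv_def by (rule someI[of "has_weak_deriv {0<..<T} y", OF g(2)])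
  have "continuous_on {0<..<T} y"
    using assms by (auto simp: W1_def intro: continuous_on_subset)
  then have ae: "AE t in lebesgue_on {0<..<T}. g t = time_deriv T y t"
    by (rule weak_deriv_AE_unique[OF g(2) wd])
  have m: "time_deriv T y \<in> borel_measurable (lebesgue_on {0<..<T})"
    by (rule borel_measurable_lebesgue_on_AE[OF _ _ ae]) (use g in \<open>auto simp: Lp_def\<close>)
  have "integrable (lebesgue_on {0<..<T}) (\<lambda>t. norm (g t) powr p)"
    using g by (simp add: Lp_def)
  then have "integrable (lebesgue_on {0<..<T}) (\<lambda>t. norm (time_deriv T y t) powr p)"
  proof (rule integrable_cong_AE_imp)
    show "AE t in lebesgue_on {0<..<T}. norm (g t) powr p = norm (time_deriv T y t) powr p"
      using ae by eventually_elim simp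
  qed (use m in measurable)
  with m show "time_deriv T y \<in> Lp {0<..<T} p" by (simp add: Lp_def)
qed

lemma W1_time_deriv_abs_integrable:
  fixes y :: "real \<Rightarrow> 'a::euclidean_space"
  assumes "y \<in> W1 T p" "1 \<le> p"
  shows "time_deriv T y absolutely_integrable_on {0..T}"
  using Lp_imp_integrable[OF W1_time_deriv(2)[OF assms(1)] assms(2)]
  by (simp add: integrable_Ioo_iff_absolutely_integrable_Icc)

text \<open>The weak formulation reaches only points inside the open interval. There
  \<open>F\<close>, which is \<open>y\<close> minus the primitive of its derivative, is constant;
  being continuous up to the ends, it is constant on \<open>[0,T]\<close>.\<close>

lemma W1_FTC:
  fixes y :: "real \<Rightarrow> 'a::euclidean_space"
  assumes y: "y \<in> W1 T p" "1 \<le> p" and ab: "0 \<le> a" "a \<le> b" "b \<le> T"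
  shows "y b - y a = integral {a..b} (time_deriv T y)"
proof (cases "a < b")
  case True
  let ?g = "time_deriv T y"
  define F where "F t = y t - integral {0..t} ?g" for t
  have gi: "?g integrable_on {0..T}"
    using W1_time_deriv_abs_integrable[OF y] by (rule set_lebesgue_integral_eq_integral(1))
  have cy: "continuous_on {0..T} y" using y by (simp add: W1_def)
  have cF: "continuous_on {0..T} F"
    unfolding F_def by (intro continuous_on_diff cy indefinite_integral_continuous_1 gi)
  have F_diff: "F d - F c = (y d - y c) - integral {c..d} ?g" if "0 \<le> c" "c \<le> d" "d \<le> T" for c d
  proof -
    have "?g integrable_on {0..d}" by (rule integrable_on_subinterval[OF gi]) (use that in auto)
    then have "integral {0..c} ?g + integral {c..d} ?g = integral {0..d} ?g"
      using that by (intro Henstock_Kurzweil_Integration.integral_combine)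
    then show ?thesis by (simp add: F_def algebra_simps)
  qed
  have "continuous_on {0<..<T} y" by (rule continuous_on_subset[OF cy]) auto
  note FTC = weak_deriv_FTC[OF W1_time_deriv(1)[OF y(1)] this]
  have mono_const: "F c = F d" if "0 < c" "c \<le> d" "d < T" for c d
    using F_diff[of c d] FTC[of c d] that by simp
  then have const: "F t = F ((a + b) / 2)" if "t \<in> {0<..<T}" for t
  proof (cases "t \<le> (a + b) / 2")
    case le: True
    show ?thesis by (rule mono_const) (use le that True ab in auto)
  next
    case False
    show ?thesis by (rule mono_const[symmetric]) (use False that True ab in auto)
  qed
  have "0 < T" using True ab by simp
  then have "F t = F ((a + b) / 2)" if "t \<in> {0..T}" for t
    using continuous_constant_on_closure[of "{0<..<T}" F "F ((a + b) / 2)" t] const cF that by simp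
  from this[of a] this[of b] have "F b = F a" using ab True by simp
  then show ?thesis using F_diff[of a b] ab by simp
qed (use ab in auto)

text \<open>The zero initial value lets the derivative alone dominate the sup norm, with embedding
  constant one.\<close>

lemma W10_norm_le:
  fixes y :: "real \<Rightarrow> 'a::euclidean_space"
  assumes y: "y \<in> W10 T p" "1 \<le> p" and t: "t \<in> {0..T}"
  shows "norm (y t) \<le> (LINT s|lebesgue_on {0<..<T}. norm (time_deriv T y s))"
proof -
  let ?g = "time_deriv T y"
  have y1: "y \<in> W1 T p" "y 0 = 0" using y by (auto simp: W10_def)
  have g: "?g absolutely_integrable_on {0..T}" by (rule W1_time_deriv_abs_integrable[OF y1(1) y(2)])
  then have ng: "(\<lambda>s. norm (?g s)) absolutely_integrable_on {0..T}"
    by (rule absolutely_integrable_norm[unfolded o_def])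
  have gt: "?g absolutely_integrable_on {0..t}"
    by (rule set_integrable_subset[OF g]) (use t in auto)
  have "norm (y t) = norm (integral {0..t} ?g)"
    using W1_FTC[OF y1(1) y(2), of 0 t] y1 t by simp
  also have "\<dots> \<le> integral {0..t} (\<lambda>s. norm (?g s))"
    using gt by (intro integral_norm_bound_integral) (auto simp: absolutely_integrable_on_def)
  also have "\<dots> \<le> integral {0..T} (\<lambda>s. norm (?g s))"
    using gt ng t by (intro integral_subset_le) (auto simp: absolutely_integrable_on_def)
  also have "\<dots> = (LINT s|lebesgue_on {0<..<T}. norm (?g s))"
    by (rule LINT_Ioo_eq_integral[OF ng, symmetric])
  finally show ?thesis .
qed

lemma W10_norm_le_W11_norm:
  fixes y :: "real \<Rightarrow> 'a::euclidean_space"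
  assumes "y \<in> W10 T 1" "t \<in> {0..T}"
  shows "norm (y t) \<le> W11_norm T y"
proof -
  have "norm (y t) \<le> Lp_norm {0<..<T} 1 (time_deriv T y)"
    using W10_norm_le[OF assms(1) _ assms(2)] by (simp add: Lp_norm_def)
  moreover have "0 \<le> Lp_norm {0<..<T} 1 y" by (simp add: Lp_norm_def)
  ultimately show ?thesis by (simp add: W11_norm_def)
qed

lemma norm_powr_2: "norm x powr 2 = (norm x)\<^sup>2"
  by (cases "x = 0") (auto simp: powr_numeral)

text \<open>The pointwise inequality \<open>x <= 1 + x^2\<close>, integrated, takes the place of
  Cauchy-Schwarz: any explicit bound by the squared \<open>L2\<close> norm serves the purpose, and
  \<open>T\<close> is the integral of 1.\<close>

lemma L2_integrable_norm_le:
  fixes f :: "real \<Rightarrow> 'a::euclidean_space"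
  assumes f: "f \<in> L2 T" and "0 \<le> T"
  shows "(LINT t|lebesgue_on {0<..<T}. norm (f t)) \<le> T + (LINT t|lebesgue_on {0<..<T}. (norm (f t))\<^sup>2)"
proof -
  interpret finite_measure "lebesgue_on {0<..<T}" by (rule finite_measure_lebesgue_on_Ioo)
  have i2: "integrable (lebesgue_on {0<..<T}) (\<lambda>t. (norm (f t))\<^sup>2)"
    using f by (simp add: Lp_def norm_powr_2)
  have "(LINT t|lebesgue_on {0<..<T}. norm (f t)) \<le> (LINT t|lebesgue_on {0<..<T}. 1 + (norm (f t))\<^sup>2)"
  proof (rule integral_mono)
    show "integrable (lebesgue_on {0<..<T}) (\<lambda>t. norm (f t))"
      using Lp_imp_integrable[OF f] by simp
    fix t
    show "norm (f t) \<le> 1 + (norm (f t))\<^sup>2"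
      using zero_le_power2[of "norm (f t) - 1/2"] by (simp add: power2_eq_square algebra_simps)
  qed (use i2 in auto)
  also have "\<dots> = T + (LINT t|lebesgue_on {0<..<T}. (norm (f t))\<^sup>2)"
    using i2 \<open>0 \<le> T\<close> by (simp add: measure_restrict_space)
  finally show ?thesis .
qed

text \<open>Turns \<open>H1\<close> bounds on the loads into uniform pointwise bounds; the quadratic
  form is inherited from the crude estimate of the \<open>L1\<close> norm.\<close>

lemma H10_norm_le:
  fixes y :: "real \<Rightarrow> 'a::euclidean_space"
  assumes y: "y \<in> H10 T" and "t \<in> {0..T}"
  shows "norm (y t) \<le> T + (H1_norm T y)\<^sup>2"
proof -
  have g: "time_deriv T y \<in> L2 T" using y by (intro W1_time_deriv) (simp add: W10_def)
  have "norm (y t) \<le> (LINT s|lebesgue_on {0<..<T}. norm (time_deriv T y s))"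
    using W10_norm_le[OF y _ assms(2)] by simp
  also have "\<dots> \<le> T + (LINT t|lebesgue_on {0<..<T}. (norm (time_deriv T y t))\<^sup>2)"
    using L2_integrable_norm_le[OF g] assms by simp
  also have "\<dots> = T + L2_inner {0<..<T} (time_deriv T y) (time_deriv T y)"
    by (simp add: L2_inner_def power2_norm_eq_inner)
  also have "\<dots> \<le> T + H1_inner T y y"
    by (simp add: H1_inner_def L2_inner_def)
  also have "H1_inner T y y = (H1_norm T y)\<^sup>2"
    by (simp add: H1_norm_def H1_inner_def L2_inner_def)
  finally show ?thesis .
qed

section \<open>Differences of \<open>H10\<close> functions\<close>

lemma Lp2_diff:
  fixes f g :: "real \<Rightarrow> 'a::euclidean_space"
  assumes "f \<in> Lp D 2" "g \<in> Lp D 2"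
  shows "(\<lambda>t. f t - g t) \<in> Lp D 2"
proof -
  have m: "f \<in> borel_measurable (lebesgue_on D)" "g \<in> borel_measurable (lebesgue_on D)"
    and i: "integrable (lebesgue_on D) (\<lambda>t. (norm (f t))\<^sup>2)" "integrable (lebesgue_on D) (\<lambda>t. (norm (g t))\<^sup>2)"
    using assms by (auto simp: Lp_def norm_powr_2)
  have "integrable (lebesgue_on D) (\<lambda>t. 2 * (norm (f t))\<^sup>2 + 2 * (norm (g t))\<^sup>2)"
    using i by auto
  then have "integrable (lebesgue_on D) (\<lambda>t. (norm (f t - g t))\<^sup>2)"
  proof (rule Bochner_Integration.integrable_bound)
    show "AE t in lebesgue_on D. norm ((norm (f t - g t))\<^sup>2) \<le> norm (2 * (norm (f t))\<^sup>2 + 2 * (norm (g t))\<^sup>2)"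
    proof (rule AE_I2)
      fix t
      have "(norm (f t - g t))\<^sup>2 \<le> (norm (f t) + norm (g t))\<^sup>2"
        by (intro power_mono norm_triangle_ineq4) auto
      also have "\<dots> \<le> 2 * (norm (f t))\<^sup>2 + 2 * (norm (g t))\<^sup>2"
        using zero_le_power2[of "norm (f t) - norm (g t)"] by (simp add: power2_eq_square algebra_simps)
      finally show "norm ((norm (f t - g t))\<^sup>2) \<le> norm (2 * (norm (f t))\<^sup>2 + 2 * (norm (g t))\<^sup>2)"
        by simp
    qed
  qed (use m in measurable)
  then show ?thesis using m by (auto simp: Lp_def norm_powr_2)
qed

text \<open>Splitting the integrals requires products with the test function to be integrable on all
  of \<open>D\<close>, although the factors are only locally integrable. The compact support of the
  test function, shared by its derivative, provides that.\<close>

lemma has_weak_deriv_diff: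
  fixes y z :: "real \<Rightarrow> 'a::euclidean_space"
  assumes "has_weak_deriv D y g" "has_weak_deriv D z h" "D \<in> sets lebesgue"
  shows "has_weak_deriv D (\<lambda>t. y t - z t) (\<lambda>t. g t - h t)"
proof -
  have li: "locally_integrable D y" "locally_integrable D z" "locally_integrable D g" "locally_integrable D h"
    using assms by (auto simp: has_weak_deriv_def)
  have prod: "integrable (lebesgue_on D) (\<lambda>t. \<psi> t *\<^sub>R f t)"
    if f: "locally_integrable D f" and \<psi>: "continuous_on UNIV \<psi>" and K: "compact K" "K \<subseteq> D"
      and 0: "\<And>t. t \<notin> K \<Longrightarrow> \<psi> t = 0" for \<psi> :: "real \<Rightarrow> real" and f :: "real \<Rightarrow> 'a" and K
  proof -
    have Ks: "K \<in> sets lebesgue" using K by (auto intro: lmeasurable_compact fmeasurableD)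
    have "(\<lambda>t. \<psi> t *\<^sub>R f t) absolutely_integrable_on K"
    proof (rule absolutely_integrable_bounded_measurable_product[where h="\<lambda>a b. a *\<^sub>R b"])
      show "bilinear (\<lambda>(a::real) (b::'a). a *\<^sub>R b)"
        by (simp add: bilinear_conv_bounded_bilinear bounded_bilinear_scaleR)
      show "\<psi> \<in> borel_measurable (lebesgue_on K)"
        using \<psi> by (intro measurable_restrict_space1 measurable_completion) (simp add: borel_measurable_continuous_onI)
      show "bounded (\<psi> ` K)"
        using \<psi> K by (intro compact_imp_bounded compact_continuous_image) (auto intro: continuous_on_subset)
      show "f absolutely_integrable_on K"
        using f K Ks by (auto simp: locally_integrable_def simp flip: integrable_lebesgue_on_iff)
    qed (fact Ks)
    then have "integrable (lebesgue_on K) (\<lambda>t. \<psi> t *\<^sub>R f t)"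
      using Ks by (simp add: integrable_lebesgue_on_iff)
    then show ?thesis
      by (subst lebesgue_on_zero_off(1)[of K]) (use 0 K Ks assms(3) in auto)
  qed
  show ?thesis
    unfolding has_weak_deriv_def
  proof (intro conjI allI impI)
    show "locally_integrable D (\<lambda>t. y t - z t)" "locally_integrable D (\<lambda>t. g t - h t)"
      using li unfolding locally_integrable_def by auto
    fix \<phi> \<phi>' assume tf: "test_function D \<phi> \<phi>'"
    then obtain K where K: "compact K" "K \<subseteq> D" "\<And>t. t \<notin> K \<Longrightarrow> \<phi> t = 0"
      and d: "\<And>t. (\<phi> has_real_derivative \<phi>' t) (at t)" and c': "continuous_on UNIV \<phi>'"
      by (auto simp: test_function_def)
    have c: "continuous_on UNIV \<phi>"
      by (intro continuous_at_imp_continuous_on ballI DERIV_isCont[OF d])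
    \<comment> \<open>\<open>\<phi>\<close> vanishes on the open complement of \<open>K\<close>,
      hence so does its derivative.\<close>
    have 0: "\<phi>' t = 0" if "t \<notin> K" for t
    proof -
      have "open (- K)" using K by (simp add: compact_imp_closed open_Compl)
      then have "((\<lambda>t. 0) has_real_derivative \<phi>' t) (at t)"
        by (rule has_field_derivative_transform_within_open[OF d]) (use that K in auto)
      then show ?thesis using DERIV_unique DERIV_const by blast
    qed
    note p' = prod[OF _ c' K(1,2) 0] and p = prod[OF _ c K(1,2,3)]
    have "(LINT t|lebesgue_on D. \<phi>' t *\<^sub>R (y t - z t)) = (LINT t|lebesgue_on D. \<phi>' t *\<^sub>R y t) - (LINT t|lebesgue_on D. \<phi>' t *\<^sub>R z t)"
      unfolding scaleR_diff_right using li by (intro Bochner_Integration.integral_diff p')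
    also have "\<dots> = - ((LINT t|lebesgue_on D. \<phi> t *\<^sub>R g t) - (LINT t|lebesgue_on D. \<phi> t *\<^sub>R h t))"
      using assms tf by (auto simp: has_weak_deriv_def)
    also have "\<dots> = - (LINT t|lebesgue_on D. \<phi> t *\<^sub>R (g t - h t))"
      unfolding scaleR_diff_right using li by (subst Bochner_Integration.integral_diff) (auto intro: p)
    finally show "(LINT t|lebesgue_on D. \<phi>' t *\<^sub>R (y t - z t)) = - (LINT t|lebesgue_on D. \<phi> t *\<^sub>R (g t - h t))" .
  qed
qed

lemma H10_diff:
  fixes y z :: "real \<Rightarrow> 'a::euclidean_space"
  assumes "y \<in> H10 T" "z \<in> H10 T"
  shows "(\<lambda>t. y t - z t) \<in> H10 T"
proof -
  obtain g h where "y \<in> L2 T" "z \<in> L2 T" "g \<in> L2 T" "h \<in> L2 T"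
    "has_weak_deriv {0<..<T} y g" "has_weak_deriv {0<..<T} z h"
    using assms by (auto simp: W10_def W1_def W1p_def)
  then have "(\<lambda>t. y t - z t) \<in> W1p {0<..<T} 2"
    unfolding W1p_def by (auto intro!: Lp2_diff has_weak_deriv_diff bexI[of _ "\<lambda>t. g t - h t"])
  then show ?thesis using assms by (auto simp: W10_def W1_def intro: continuous_on_diff)
qed

section \<open>Boundedness of the states and of the derivative of the objective\<close>

text \<open>Carries almost-everywhere statements on the open time interval over to gauge integrals
  on closed subintervals that may touch \<open>0\<close> or \<open>T\<close>.\<close>

lemma integral_le_AE:
  fixes f g :: "real \<Rightarrow> real"
  assumes f: "f integrable_on {a..b}" and g: "g integrable_on {a..b}" and ab: "0 \<le> a" "b \<le> T"
    and ae: "AE t in lebesgue_on {0<..<T}. t \<in> {a..b} \<longrightarrow> f t \<le> g t"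
  shows "integral {a..b} f \<le> integral {a..b} g"
proof -
  have "AE t in lebesgue. t \<in> {0<..<T} \<longrightarrow> t \<in> {a..b} \<longrightarrow> f t \<le> g t"
    using ae by (simp add: AE_restrict_space_iff)
  then obtain N where N: "negligible N" "{t. \<not> (t \<in> {0<..<T} \<longrightarrow> t \<in> {a..b} \<longrightarrow> f t \<le> g t)} \<subseteq> N"
    by (auto simp: eventually_ae_filter negligible_iff_null_sets)
  \<comment> \<open>The endpoints join the null set, since the hypothesis says nothing about
    them.\<close>
  define N' where "N' = N \<union> {0, T}"
  have N': "negligible N'" using N by (auto simp: N'_def)
  have le: "f t \<le> g t" if "t \<in> {a..b} - N'" for t
  proof (rule ccontr)
    assume "\<not> f t \<le> g t"
    then have "t \<in> N" using that ab by (intro subsetD[OF N(2)]) (auto simp: N'_def)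
    then show False using that by (simp add: N'_def)
  qed
  have "integral {a..b} f = integral {a..b} (\<lambda>t. if t \<in> N' then 0 else f t)"
    by (rule integral_spike[OF N']) auto
  also have "\<dots> \<le> integral {a..b} (\<lambda>t. if t \<in> N' then 0 else g t)"
  proof (rule integral_le)
    show "(\<lambda>t. if t \<in> N' then 0 else f t) integrable_on {a..b}"
      by (rule integrable_spike[OF f N']) auto
    show "(\<lambda>t. if t \<in> N' then 0 else g t) integrable_on {a..b}"
      by (rule integrable_spike[OF g N']) auto
  qed (use le in auto)
  also have "\<dots> = integral {a..b} g"
    by (rule integral_spike[OF N']) auto
  finally show ?thesis .
qed

text \<open>Comparison with \<open>\<eta>\<close> after erasing its \<open>i\<close>-th entry
  decouples the components and leaves \<open>\<kappa>(\<zeta>_i) \<eta>_i + (e/2) \<eta>_i^2 <= g_i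
  \<eta>_i\<close>. As \<open>\<kappa>\<close> is nonnegative, the quadratic term makes
  \<open>g_i\<close> strictly positive wherever \<open>\<eta>_i\<close> is not zero.\<close>

lemma subdifferential_dissip_eps:
  fixes \<zeta> \<eta> g :: "real ^ 'n"
  assumes e: "0 < e" and \<kappa>: "\<And>x. 0 \<le> \<kappa> x" and g: "g \<in> subdifferential (dissip_eps \<kappa> e \<zeta>) \<eta>"
  shows "0 \<le> \<eta> $ i" and "\<eta> $ i \<noteq> 0 \<Longrightarrow> 0 < g $ i"
proof -
  have sub: "dissip_eps \<kappa> e \<zeta> \<eta> + ereal (g \<bullet> (w - \<eta>)) \<le> dissip_eps \<kappa> e \<zeta> w" for w
    using g by (auto simp: subdifferential_def)
  \<comment> \<open>Otherwise the left side of \<open>sub\<close> would be infinite, while the right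
    side is finite at \<open>w = 0\<close>.\<close>
  have \<eta>: "\<eta> \<in> nonneg_cone"
  proof (rule ccontr)
    assume "\<eta> \<notin> nonneg_cone"
    moreover have "(0 :: real ^ 'n) \<in> nonneg_cone" by (simp add: nonneg_cone_def)
    ultimately show False using sub[of 0] by (simp add: dissip_eps_def)
  qed
  then have pos: "0 \<le> \<eta> $ k" for k by (simp add: nonneg_cone_def)
  then show "0 \<le> \<eta> $ i" .
  define w where "w = \<eta> - axis i (\<eta> $ i)"
  have w: "w \<in> nonneg_cone"
    using pos by (simp add: w_def nonneg_cone_def axis_def)
  have "cw \<kappa> \<zeta> \<bullet> \<eta> + e / 2 * (norm \<eta>)\<^sup>2 + g \<bullet> (w - \<eta>) \<le> cw \<kappa> \<zeta> \<bullet> w + e / 2 * (norm w)\<^sup>2"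
    using sub[of w] \<eta> w by (simp add: dissip_eps_def)
  moreover have "(norm w)\<^sup>2 = (norm \<eta>)\<^sup>2 - (\<eta> $ i)\<^sup>2"
    unfolding w_def power2_norm_eq_inner
    by (simp add: inner_diff_left inner_diff_right inner_axis inner_axis' power2_eq_square)
  moreover have "g \<bullet> (w - \<eta>) = - g $ i * \<eta> $ i"
    by (simp add: w_def inner_axis)
  moreover have "cw \<kappa> \<zeta> \<bullet> w = cw \<kappa> \<zeta> \<bullet> \<eta> - cw \<kappa> \<zeta> $ i * \<eta> $ i"
    by (simp add: w_def inner_diff_right inner_axis)
  ultimately have le: "cw \<kappa> \<zeta> $ i * \<eta> $ i + e / 2 * (\<eta> $ i)\<^sup>2 \<le> g $ i * \<eta> $ i"
    by (simp add: algebra_simps)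
  show "0 < g $ i" if "\<eta> $ i \<noteq> 0"
  proof -
    have \<eta>i: "0 < \<eta> $ i" using that pos[of i] by simp
    have "0 < e / 2 * (\<eta> $ i)\<^sup>2" using e \<eta>i by simp
    moreover have "0 \<le> cw \<kappa> \<zeta> $ i * \<eta> $ i" using \<kappa> pos[of i] by (simp add: cw_def)
    ultimately have "0 < g $ i * \<eta> $ i" using le by linarith
    then show ?thesis using \<eta>i by (simp add: zero_less_mult_iff)
  qed
qed

text \<open>Above the level \<open>M\<close> the rate vanishes, and monotonicity keeps
  \<open>q\<close> above any level once it is reached. So \<open>q\<close> would stay for ever at an
  intermediate value between \<open>M\<close> and a supposed larger \<open>q t\<close>.\<close>

lemma mono_bounded_by_growth_condition:
  fixes q q' :: "real \<Rightarrow> real"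
  assumes q: "continuous_on {0..T} q" "q 0 = 0" and M: "0 \<le> M"
    and FTC: "\<And>a b. 0 \<le> a \<Longrightarrow> a \<le> b \<Longrightarrow> b \<le> T \<Longrightarrow> q b - q a = integral {a..b} q'"
    and q': "q' integrable_on {0..T}"
    and ae: "AE t in lebesgue_on {0<..<T}. 0 \<le> q' t \<and> (q' t \<noteq> 0 \<longrightarrow> q t \<le> M)"
  shows "\<And>s t. 0 \<le> s \<Longrightarrow> s \<le> t \<Longrightarrow> t \<le> T \<Longrightarrow> q s \<le> q t"
    and "\<And>t. 0 \<le> t \<Longrightarrow> t \<le> T \<Longrightarrow> q t \<le> M"
proof -
  have int: "q' integrable_on {s..t}" if "0 \<le> s" "t \<le> T" for s t
    by (rule integrable_on_subinterval[OF q']) (use that in auto)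
  show mono: "q s \<le> q t" if "0 \<le> s" "s \<le> t" "t \<le> T" for s t
  proof -
    have "integral {s..t} (\<lambda>t. 0) \<le> integral {s..t} q'"
    proof (rule integral_le_AE[where T=T])
      show "AE u in lebesgue_on {0<..<T}. u \<in> {s..t} \<longrightarrow> 0 \<le> q' u"
        using ae by eventually_elim simp
    qed (use int that in auto)
    then show ?thesis using FTC[OF that] by simp
  qed
  show "q t \<le> M" if t: "0 \<le> t" "t \<le> T" for t
  proof (rule ccontr)
    assume "\<not> q t \<le> M"
    then have big: "M < q t" by simp
    \<comment> \<open>A level strictly above \<open>M\<close>, attained before \<open>t\<close>
      because \<open>q 0 = 0 <= M\<close>.\<close>
    define v where "v = (M + q t) / 2"
    have v: "M < v" "v < q t" using big by (auto simp: v_def)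
    have "\<exists>s\<ge>0. s \<le> t \<and> q s = v"
      by (rule IVT') (use v M q t in \<open>auto intro: continuous_on_subset\<close>)
    then obtain s where s: "0 \<le> s" "s \<le> t" "q s = v" by blast
    have "integral {s..t} q' \<le> integral {s..t} (\<lambda>t. 0)"
    proof (rule integral_le_AE[where T=T])
      show "AE u in lebesgue_on {0<..<T}. u \<in> {s..t} \<longrightarrow> q' u \<le> 0"
        using ae
      proof eventually_elim
        case (elim u)
        show ?case
        proof
          assume "u \<in> {s..t}"
          then have "v \<le> q u" using mono[of s u] s t by simp
          then show "q' u \<le> 0" using elim v by (cases "q' u = 0") auto
        qed
      qed
    qed (use int s t in auto)
    then show False using FTC[of s t] s t v by simp
  qed
qed

lemma W1_FTC_component:
  fixes y :: "real \<Rightarrow> real ^ 'n"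
  assumes y: "y \<in> W1 T p" "1 \<le> p"
  shows "(\<lambda>t. time_deriv T y t $ i) absolutely_integrable_on {0..T}"
    and "\<And>a b. 0 \<le> a \<Longrightarrow> a \<le> b \<Longrightarrow> b \<le> T \<Longrightarrow> y b $ i - y a $ i = integral {a..b} (\<lambda>t. time_deriv T y t $ i)"
proof -
  let ?g = "time_deriv T y"
  have ai: "?g absolutely_integrable_on {0..T}" by (rule W1_time_deriv_abs_integrable[OF y])
  then have "(\<lambda>t. ?g t \<bullet> axis i 1) absolutely_integrable_on {0..T}"
    by (rule absolutely_integrable_component)
  then show "(\<lambda>t. ?g t $ i) absolutely_integrable_on {0..T}"
    by (simp add: inner_axis)
  show "y b $ i - y a $ i = integral {a..b} (\<lambda>t. ?g t $ i)" if "0 \<le> a" "a \<le> b" "b \<le> T" for a b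
  proof -
    have "?g integrable_on {a..b}"
      by (rule integrable_on_subinterval[OF set_lebesgue_integral_eq_integral(1)[OF ai]]) (use that in auto)
    then show ?thesis
      using W1_FTC[OF y that] by (simp add: integral_component_eq_cart flip: vector_minus_component)
  qed
qed

text \<open>Neither conclusion involves \<open>e\<close>: what survives from the inclusion is the
  sign of the rate and the inequality \<open>\<alpha> q < l\<close> where the rate is nonzero, and
  the load enters through an upper bound.\<close>

lemma state_eps_bounds:
  fixes l q :: "real \<Rightarrow> real ^ 'n"
  assumes \<alpha>: "0 < \<alpha>" and e: "0 < e" and \<kappa>: "\<And>x. 0 \<le> \<kappa> x" and M: "0 \<le> M"
    and sol: "solves T \<alpha> y0 (dissip_eps \<kappa> e) l q"
    and l: "\<And>t. t \<in> {0..T} \<Longrightarrow> l t $ i \<le> M"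
  shows "\<And>s t. 0 \<le> s \<Longrightarrow> s \<le> t \<Longrightarrow> t \<le> T \<Longrightarrow> q s $ i \<le> q t $ i"
    and "\<And>t. 0 \<le> t \<Longrightarrow> t \<le> T \<Longrightarrow> q t $ i \<le> M / \<alpha>"
proof -
  let ?q' = "time_deriv T q"
  have q: "q \<in> W1 T 2" "q 0 = 0" and
    incl: "AE t in lebesgue_on {0<..<T}.
        - \<alpha> *\<^sub>R q t + l t \<in> subdifferential (dissip_eps \<kappa> e (hist y0 q t)) (?q' t)"
    using sol by (auto simp: solves_def W10_def)
  have 1: "continuous_on {0..T} (\<lambda>t. q t $ i)"
    using q(1) by (intro continuous_on_component) (simp add: W1_def)
  have 2: "q b $ i - q a $ i = integral {a..b} (\<lambda>t. ?q' t $ i)" if "0 \<le> a" "a \<le> b" "b \<le> T" for a b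
    using that by (intro W1_FTC_component[OF q(1)]) auto
  have 3: "AE t in lebesgue_on {0<..<T}. 0 \<le> ?q' t $ i \<and> (?q' t $ i \<noteq> 0 \<longrightarrow> q t $ i \<le> M / \<alpha>)"
  proof -
    have "AE t in lebesgue_on {0<..<T}. t \<in> {0<..<T}" by (rule AE_I2) simp
    with incl show ?thesis
    proof eventually_elim
      case (elim t)
      note s = subdifferential_dissip_eps[OF e \<kappa> elim(1)]
      have "q t $ i \<le> M / \<alpha>" if "?q' t $ i \<noteq> 0"
        using s(2)[OF that] l[of t] elim(2) \<alpha> by (simp add: field_simps)
      with s(1) show ?case by blast
    qed
  qed
  have 0: "0 \<le> M / \<alpha>" "q 0 $ i = 0" using M \<alpha> q by auto
  have q'i: "(\<lambda>t. ?q' t $ i) integrable_on {0..T}"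
    using W1_FTC_component(1)[OF q(1)] by (simp add: set_lebesgue_integral_eq_integral(1))
  note fin = mono_bounded_by_growth_condition[OF 1 0(2) 0(1) 2 q'i 3]
  show "q s $ i \<le> q t $ i" if "0 \<le> s" "s \<le> t" "t \<le> T" for s t
    by (rule fin(1)) (use that in auto)
  show "q t $ i \<le> M / \<alpha>" if "0 \<le> t" "t \<le> T" for t
    by (rule fin(2)) (use that in auto)
qed

text \<open>Induction on the finite index set, thinning the subsequence for one more index each
  time; convergence already gained survives. For a single index, convergence holds where the
  monotone limit is continuous, that is off a countable set.\<close>

lemma Helly_selection_family:
  fixes f :: "nat \<Rightarrow> 'i \<Rightarrow> real \<Rightarrow> real"
  assumes "finite A" and cont: "\<And>n i x. continuous (at_right x) (f n i)"
    and mono: "\<And>n i. mono (f n i)" and bdd: "\<And>n i x. \<bar>f n i x\<bar> \<le> M"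
  shows "\<exists>s. strict_mono (s :: nat \<Rightarrow> nat) \<and> (\<forall>i\<in>A. AE x in lborel. convergent (\<lambda>n. f (s n) i x))"
  using \<open>finite A\<close>
proof induction
  case empty
  then show ?case using strict_mono_id by blast
next
  case (insert j A)
  then obtain s :: "nat \<Rightarrow> nat" where s: "strict_mono s" "\<And>i. i \<in> A \<Longrightarrow> AE x in lborel. convergent (\<lambda>n. f (s n) i x)"
    by blast
  obtain r :: "nat \<Rightarrow> nat" and F where r: "strict_mono r" "mono F"
    "\<And>x. continuous (at x) F \<Longrightarrow> (\<lambda>n. f (s (r n)) j x) \<longlonglongrightarrow> F x"
    using Helly_selection[of "\<lambda>n. f (s n) j" M] cont mono bdd by blast
  have "countable {x. \<not> isCont F x}"
    by (rule mono_ctble_discont[OF r(2)])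
  then have "AE x in lborel. x \<notin> {x. \<not> isCont F x}"
    by (intro AE_not_in countable_imp_null_set_lborel)
  then have "AE x in lborel. convergent (\<lambda>n. f (s (r n)) j x)"
    by eventually_elim (use r(3) in \<open>auto simp: convergent_def\<close>)
  moreover have "AE x in lborel. convergent (\<lambda>n. f (s (r n)) i x)" if "i \<in> A" for i
    using s(2)[OF that]
  proof eventually_elim
    case (elim x)
    from convergent_subseq_convergent[OF this r(1)] show ?case by (simp add: o_def)
  qed
  moreover have "strict_mono (\<lambda>n. s (r n))"
    using strict_mono_o[OF s(1) r(1)] by (simp add: o_def)
  ultimately show ?case by blast
qed

lemma Helly_selection_vec:
  fixes q :: "nat \<Rightarrow> real \<Rightarrow> real ^ 'n"
  assumes T: "0 \<le> T" and cont: "\<And>k. continuous_on {0..T} (q k)"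
    and mono: "\<And>k i s t. 0 \<le> s \<Longrightarrow> s \<le> t \<Longrightarrow> t \<le> T \<Longrightarrow> q k s $ i \<le> q k t $ i"
    and bdd: "\<And>k i t. 0 \<le> t \<Longrightarrow> t \<le> T \<Longrightarrow> \<bar>q k t $ i\<bar> \<le> M"
  obtains s :: "nat \<Rightarrow> nat" and F where "strict_mono s" "AE t in lebesgue_on {0<..<T}. (\<lambda>k. q (s k) t) \<longlonglongrightarrow> F t"
proof -
  \<comment> \<open>Constant extension beyond \<open>[0,T]\<close> preserves monotonicity,
    continuity and the bound; the selection theorem is stated on the whole line.\<close>
  define clamp where "clamp t = max 0 (min T t)" for t
  have clamp: "clamp t \<in> {0..T}" "s \<le> t \<Longrightarrow> clamp s \<le> clamp t" for s t
    using T by (auto simp: clamp_def)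
  have "\<exists>s. strict_mono (s :: nat \<Rightarrow> nat) \<and>
      (\<forall>i\<in>UNIV. AE x in lborel. convergent (\<lambda>k. q (s k) (clamp x) $ i))"
  proof (rule Helly_selection_family[where f="\<lambda>k i x. q k (clamp x) $ i"])
    show "continuous (at_right x) (\<lambda>x. q k (clamp x) $ i)" for k i x
    proof -
      have "continuous_on UNIV (\<lambda>x. q k (clamp x))"
        by (rule continuous_on_compose2[OF cont]) (use clamp in \<open>auto simp: clamp_def intro!: continuous_intros\<close>)
      then have "continuous_on UNIV (\<lambda>x. q k (clamp x) $ i)"
        by (rule continuous_on_component)
      then show ?thesis
        by (simp add: continuous_on_eq_continuous_at continuous_at_imp_continuous_at_within)
    qed
    show "mono (\<lambda>x. q k (clamp x) $ i)" for k i
      by (intro monoI mono) (use clamp in auto)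
    show "\<bar>q k (clamp x) $ i\<bar> \<le> M" for k i x
      by (intro bdd) (use clamp in auto)
  qed simp
  then obtain s :: "nat \<Rightarrow> nat" where s: "strict_mono s"
    "\<And>i. AE x in lborel. convergent (\<lambda>k. q (s k) (clamp x) $ i)" by blast
  have "AE x in lborel. \<forall>i\<in>UNIV. convergent (\<lambda>k. q (s k) (clamp x) $ i)"
    by (rule AE_finite_allI) (use s in auto)
  then have "AE x in lebesgue. \<forall>i\<in>UNIV. convergent (\<lambda>k. q (s k) (clamp x) $ i)"
    by (rule AE_completion)
  then have "AE t in lebesgue. t \<in> {0<..<T} \<longrightarrow> (\<lambda>k. q (s k) t) \<longlonglongrightarrow> (\<chi> i. lim (\<lambda>k. q (s k) t $ i))"
  proof eventually_elim
    case (elim t)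
    show ?case
    proof
      assume "t \<in> {0<..<T}"
      then have "clamp t = t" by (auto simp: clamp_def)
      then show "(\<lambda>k. q (s k) t) \<longlonglongrightarrow> (\<chi> i. lim (\<lambda>k. q (s k) t $ i))"
        using elim by (intro vec_tendstoI) (simp add: convergent_LIMSEQ_iff)
    qed
  qed
  then have "AE t in lebesgue_on {0<..<T}. (\<lambda>k. q (s k) t) \<longlonglongrightarrow> (\<chi> i. lim (\<lambda>k. q (s k) t $ i))"
    by (simp add: AE_restrict_space_iff)
  with s(1) show thesis by (rule that)
qed

text \<open>Continuity bounds \<open>dj\<close> only near each single point. A sequence along which
  \<open>dj\<close> is unbounded would have a subsequence converging in \<open>L2\<close> to some
  \<open>G\<close>, and near \<open>G\<close> the map is bounded.\<close>

lemma L2_C1_bounded_on_monotone: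
  fixes q :: "nat \<Rightarrow> real \<Rightarrow> real ^ 'n"
  assumes C1: "L2_C1 T j dj" and T: "0 \<le> T" and qL2: "\<And>k. q k \<in> L2 T" and cont: "\<And>k. continuous_on {0..T} (q k)"
    and mono: "\<And>k i s t. 0 \<le> s \<Longrightarrow> s \<le> t \<Longrightarrow> t \<le> T \<Longrightarrow> q k s $ i \<le> q k t $ i"
    and bdd: "\<And>k i t. 0 \<le> t \<Longrightarrow> t \<le> T \<Longrightarrow> \<bar>q k t $ i\<bar> \<le> M"
  obtains B where "\<And>k. (LINT t|lebesgue_on {0<..<T}. (norm (dj (q k) t))\<^sup>2) \<le> B"
proof (cases "\<exists>B. \<forall>k. (LINT t|lebesgue_on {0<..<T}. (norm (dj (q k) t))\<^sup>2) \<le> B")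
  case True
  then show ?thesis using that by blast
next
  case False
  let ?M = "lebesgue_on {0<..<T}"
  interpret finite_measure ?M by (rule finite_measure_lebesgue_on_Ioo)
  have "\<exists>k. real n < (LINT t|?M. (norm (dj (q k) t))\<^sup>2)" for n
    using False by (meson not_le)
  \<comment> \<open>\<open>r\<close> may repeat indices; the contradiction rests on the lower bound
    \<open>n\<close> together with \<open>k <= s k\<close>.\<close>
  then obtain r where r: "\<And>n. real n < (LINT t|?M. (norm (dj (q (r n)) t))\<^sup>2)" by metis
  obtain s :: "nat \<Rightarrow> nat" and F where s: "strict_mono s"
    and lim: "AE t in ?M. (\<lambda>k. q (r (s k)) t) \<longlonglongrightarrow> F t"
    using Helly_selection_vec[of T "\<lambda>k. q (r k)" M] T cont mono bdd by blast
  define p where "p k = q (r (s k))" for k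
  have pL2: "p k \<in> L2 T" for k using qL2 by (simp add: p_def)
  have pm: "p k \<in> borel_measurable ?M" for k using pL2[of k] by (simp add: Lp_def)
  define N where "N = real CARD('n) * M"
  have pb: "norm (p k t) \<le> N" if "t \<in> {0<..<T}" for k t
  proof -
    have "norm (p k t) \<le> (\<Sum>i\<in>UNIV. \<bar>p k t $ i\<bar>)" by (rule norm_le_l1_cart)
    also have "\<dots> \<le> (\<Sum>i\<in>(UNIV :: 'n set). M)"
      by (intro sum_mono) (use bdd that in \<open>auto simp: p_def\<close>)
    finally show ?thesis by (simp add: N_def)
  qed
  \<comment> \<open>\<open>F\<close> comes without measurability. The pointwise \<open>lim\<close>
    of measurable functions is measurable and agrees with \<open>F\<close> almost
    everywhere.\<close>
  define G where "G t = lim (\<lambda>k. p k t)" for t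
  have Gm: "G \<in> borel_measurable ?M"
    unfolding G_def[abs_def] using pm by (rule borel_measurable_lim_metric)
  have limG: "AE t in ?M. (\<lambda>k. p k t) \<longlonglongrightarrow> G t"
    using lim by eventually_elim (simp add: p_def G_def limI)
  have Gb: "AE t in ?M. norm (G t) \<le> N"
  proof -
    have "AE t in ?M. t \<in> {0<..<T}" by (rule AE_I2) simp
    with limG show ?thesis
    proof eventually_elim
      case (elim t)
      show ?case
        by (rule LIMSEQ_le_const2[OF tendsto_norm[OF elim(1)]]) (use pb elim(2) in auto)
    qed
  qed
  have GL2: "G \<in> L2 T"
  proof -
    have "integrable ?M (\<lambda>t. (norm (G t))\<^sup>2)"
    proof (rule integrable_const_bound)
      show "AE t in ?M. norm ((norm (G t))\<^sup>2) \<le> N\<^sup>2"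
        using Gb by eventually_elim (simp add: power_mono)
    qed (use Gm in measurable)
    then show ?thesis using Gm by (simp add: Lp_def norm_powr_2)
  qed
  \<comment> \<open>The uniform bound upgrades pointwise convergence to convergence in
    \<open>L2\<close>.\<close>
  have "(\<lambda>k. LINT t|?M. (norm (p k t - G t))\<^sup>2) \<longlonglongrightarrow> (LINT t|?M. 0)"
  proof (rule integral_dominated_convergence)
    show "(\<lambda>t. (norm (p k t - G t))\<^sup>2) \<in> borel_measurable ?M" for k
      using pm[of k] Gm by measurable
    show "integrable ?M (\<lambda>t. (2 * N)\<^sup>2)" by simp
    show "AE t in ?M. (\<lambda>k. (norm (p k t - G t))\<^sup>2) \<longlonglongrightarrow> 0"
      using limG
    proof eventually_elim
      case (elim t)
      then have "(\<lambda>k. norm (p k t - G t)) \<longlonglongrightarrow> 0" by (simp add: LIM_zero tendsto_norm_zero)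
      from tendsto_power[OF this, of 2] show ?case by simp
    qed
    show "AE t in ?M. norm ((norm (p k t - G t))\<^sup>2) \<le> (2 * N)\<^sup>2" for k
    proof -
      have "AE t in ?M. t \<in> {0<..<T}" by (rule AE_I2) simp
      with Gb show ?thesis
      proof eventually_elim
        case (elim t)
        have "norm (p k t - G t) \<le> 2 * N"
          using norm_triangle_ineq4[of "p k t" "G t"] pb[OF elim(2), of k] elim(1) by linarith
        then have "(norm (p k t - G t))\<^sup>2 \<le> (2 * N)\<^sup>2" by (intro power_mono) auto
        then show ?case by simp
      qed
    qed
  qed simp
  then have "(\<lambda>k. sqrt (LINT t|?M. (norm (p k t - G t))\<^sup>2)) \<longlonglongrightarrow> sqrt 0"
    by (intro tendsto_real_sqrt) simp
  then have pG: "(\<lambda>k. Lp_norm {0<..<T} 2 (\<lambda>t. p k t - G t)) \<longlonglongrightarrow> 0"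
    by (simp add: Lp_norm_def norm_powr_2 powr_half_sqrt)
  have "\<forall>g \<in> L2 T. \<forall>e>0. \<exists>d>0. \<forall>h \<in> L2 T. Lp_norm {0<..<T} 2 (\<lambda>t. h t - g t) < d \<longrightarrow>
        Lp_norm {0<..<T} 2 (\<lambda>t. dj h t - dj g t) < e"
    using C1 by (simp add: L2_C1_def)
  from this[rule_format, OF GL2 zero_less_one]
  obtain d where d: "0 < d" "\<And>h. h \<in> L2 T \<Longrightarrow> Lp_norm {0<..<T} 2 (\<lambda>t. h t - G t) < d \<Longrightarrow>
        Lp_norm {0<..<T} 2 (\<lambda>t. dj h t - dj G t) < 1"
    by blast
  have djL2: "dj h \<in> L2 T" if "h \<in> L2 T" for h using C1 that by (simp add: L2_C1_def)
  have "\<forall>\<^sub>F k in sequentially. Lp_norm {0<..<T} 2 (\<lambda>t. p k t - G t) < d"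
    using order_tendstoD(2)[OF pG d(1)] .
  \<comment> \<open>\<open>K\<close> comes from \<open>(a + b)^2 <= 2 a^2 + 2 b^2\<close> for the
    splitting of \<open>dj (p k)\<close> into its distance from \<open>dj G\<close>, of squared norm
    below 1, and \<open>dj G\<close>.\<close>
  moreover define K where "K = 2 + 2 * (LINT t|?M. (norm (dj G t))\<^sup>2)"
  have "\<forall>\<^sub>F k in sequentially. K < real k"
    by real_asymp
  ultimately have "\<forall>\<^sub>F k in sequentially. False"
  proof eventually_elim
    case (elim k)
    have "Lp_norm {0<..<T} 2 (\<lambda>t. dj (p k) t - dj G t) < 1"
      by (rule d(2)[OF pL2 elim(1)])
    then have lt: "(LINT t|?M. (norm (dj (p k) t - dj G t))\<^sup>2) < 1"
      by (simp add: Lp_norm_def norm_powr_2 powr_half_sqrt)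
    have i1: "integrable ?M (\<lambda>t. (norm (dj (p k) t - dj G t))\<^sup>2)"
      using Lp2_diff[OF djL2[OF pL2[of k]] djL2[OF GL2]] by (simp add: Lp_def norm_powr_2)
    have i2: "integrable ?M (\<lambda>t. (norm (dj G t))\<^sup>2)"
      using djL2[OF GL2] by (simp add: Lp_def norm_powr_2)
    have i3: "integrable ?M (\<lambda>t. (norm (dj (p k) t))\<^sup>2)"
      using djL2[OF pL2[of k]] by (simp add: Lp_def norm_powr_2)
    have "(LINT t|?M. (norm (dj (p k) t))\<^sup>2) \<le>
        (LINT t|?M. 2 * (norm (dj (p k) t - dj G t))\<^sup>2 + 2 * (norm (dj G t))\<^sup>2)"
    proof (rule integral_mono)
      fix t
      have "(norm (dj (p k) t))\<^sup>2 \<le> (norm (dj (p k) t - dj G t) + norm (dj G t))\<^sup>2"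
        using norm_triangle_ineq[of "dj (p k) t - dj G t" "dj G t"] by (intro power_mono) auto
      also have "\<dots> \<le> 2 * (norm (dj (p k) t - dj G t))\<^sup>2 + 2 * (norm (dj G t))\<^sup>2"
        using zero_le_power2[of "norm (dj (p k) t - dj G t) - norm (dj G t)"]
        by (simp add: power2_eq_square algebra_simps)
      finally show "(norm (dj (p k) t))\<^sup>2 \<le> 2 * (norm (dj (p k) t - dj G t))\<^sup>2 + 2 * (norm (dj G t))\<^sup>2" .
    qed (use i1 i2 i3 in auto)
    also have "\<dots> = 2 * (LINT t|?M. (norm (dj (p k) t - dj G t))\<^sup>2) + 2 * (LINT t|?M. (norm (dj G t))\<^sup>2)"
      using i1 i2 by simp
    also have "\<dots> < K" using lt by (simp add: K_def)
    finally have "(LINT t|?M. (norm (dj (p k) t))\<^sup>2) < K" .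
    moreover have "real (s k) < (LINT t|?M. (norm (dj (p k) t))\<^sup>2)"
      using r[of "s k"] by (simp add: p_def)
    moreover have "k \<le> s k" using s by (rule seq_suble)
    ultimately show False using elim(2) by linarith
  qed
  then show ?thesis by simp
qed

section \<open>The adjoint equation\<close>

text \<open>Both facts pass to the limit from the difference quotients \<open>D n\<close>, which are
  continuous in \<open>x\<close> and bounded by the Lipschitz constant.\<close>

lemma lipschitz_deriv_bound:
  fixes \<kappa> :: "real \<Rightarrow> real"
  assumes "L-lipschitz_on UNIV \<kappa>" and "\<And>x. \<kappa> field_differentiable at x"
  shows "\<bar>deriv \<kappa> x\<bar> \<le> L" and "deriv \<kappa> \<in> borel_measurable borel"
proof -
  define D where "D n x = (\<kappa> (x + 1 / real (Suc n)) - \<kappa> x) / (1 / real (Suc n))" for n x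
  have der: "(\<kappa> has_real_derivative deriv \<kappa> x) (at x)" for x
    using assms(2) by (rule DERIV_deriv_iff_field_differentiable[THEN iffD2])
  have D: "(\<lambda>n. D n x) \<longlonglongrightarrow> deriv \<kappa> x" for x
  proof -
    have "filterlim (\<lambda>n. 1 / real (Suc n)) (at 0) sequentially"
      by (intro filterlim_atI) (use LIMSEQ_Suc[OF lim_1_over_n] in auto)
    then show ?thesis
      using der[of x, unfolded DERIV_def] unfolding D_def
      by (rule filterlim_compose[rotated])
  qed
  have "\<bar>D n x\<bar> \<le> L" for n
  proof -
    have "dist (\<kappa> (x + 1 / real (Suc n))) (\<kappa> x) \<le> L * dist (x + 1 / real (Suc n)) x"
      by (rule lipschitz_onD[OF assms(1)]) auto
    then have "\<bar>\<kappa> (x + 1 / real (Suc n)) - \<kappa> x\<bar> \<le> L * (1 / real (Suc n))"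
      by (simp add: dist_real_def del: of_nat_Suc)
    then show ?thesis
      unfolding D_def abs_divide by (subst pos_divide_le_eq) auto
  qed
  then show "\<bar>deriv \<kappa> x\<bar> \<le> L"
    by (intro LIMSEQ_le_const2[OF tendsto_rabs[OF D]]) auto
  have c: "continuous_on UNIV \<kappa>"
    by (intro continuous_at_imp_continuous_on ballI DERIV_isCont[OF der])
  have "continuous_on UNIV (\<lambda>x. \<kappa> (x + 1 / real (Suc n)))" for n
    by (rule continuous_on_compose2[OF c]) (auto intro!: continuous_intros)
  then have Dm: "D n \<in> borel_measurable borel" for n
    unfolding D_def by (intro borel_measurable_continuous_onI continuous_intros c) auto
  show "deriv \<kappa> \<in> borel_measurable borel"
    by (rule borel_measurable_LIMSEQ_real[OF D Dm])
qed

text \<open>Fubini on the triangle \<open>s <= t\<close>, dominated by the product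
  \<open>|v s| |u t|\<close>. Integration over the past is exchanged for integration over the
  future, which is why the adjoint runs backward from \<open>T\<close>.\<close>

lemma Volterra_duality:
  fixes v u :: "real \<Rightarrow> real"
  assumes v: "integrable (lebesgue_on {0<..<T}) v" and u: "integrable (lebesgue_on {0<..<T}) u"
  shows "(\<lambda>t. LINT s|lebesgue_on {0<..<T}. indicat_real {..t} s * v s) \<in> borel_measurable (lebesgue_on {0<..<T})"
    and "(\<lambda>s. LINT t|lebesgue_on {0<..<T}. indicat_real {s..} t * u t) \<in> borel_measurable (lebesgue_on {0<..<T})"
    and "(LINT t|lebesgue_on {0<..<T}. (LINT s|lebesgue_on {0<..<T}. indicat_real {..t} s * v s) * u t)
      = (LINT s|lebesgue_on {0<..<T}. v s * (LINT t|lebesgue_on {0<..<T}. indicat_real {s..} t * u t))"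
proof -
  let ?M = "lebesgue_on {0<..<T}"
  interpret M: finite_measure ?M by (rule finite_measure_lebesgue_on_Ioo)
  interpret P: pair_sigma_finite ?M ?M ..
  have [measurable]: "v \<in> borel_measurable ?M" "u \<in> borel_measurable ?M" using v u by auto
  have id[measurable]: "(\<lambda>t. t) \<in> borel_measurable ?M"
    by (intro measurable_restrict_space1 measurable_completion) simp
  have le[measurable]: "Measurable.pred (?M \<Otimes>\<^sub>M ?M) (\<lambda>p. fst p \<le> snd p)" by measurable
  have le'[measurable]: "Measurable.pred (?M \<Otimes>\<^sub>M ?M) (\<lambda>p. snd p \<le> fst p)" by measurable
  have ind: "indicat_real {..t} s = of_bool (s \<le> t)" "indicat_real {s..} t = of_bool (s \<le> t)" for s t
    by (auto simp: indicator_def)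
  show "(\<lambda>t. LINT s|?M. indicat_real {..t} s * v s) \<in> borel_measurable ?M"
    unfolding ind by (rule M.borel_measurable_lebesgue_integral) (simp add: case_prod_beta')
  show "(\<lambda>s. LINT t|?M. indicat_real {s..} t * u t) \<in> borel_measurable ?M"
    unfolding ind by (rule M.borel_measurable_lebesgue_integral) (simp add: case_prod_beta')
  define f where "f s t = of_bool (s \<le> t) * (v s * u t)" for s t :: real
  have fm: "case_prod f \<in> borel_measurable (?M \<Otimes>\<^sub>M ?M)"
    unfolding f_def[abs_def] by (simp add: case_prod_beta')
  have fs: "integrable ?M (f s)" for s
  proof (rule Bochner_Integration.integrable_bound)
    show "integrable ?M (\<lambda>t. v s * u t)" using u by simp
    show "f s \<in> borel_measurable ?M" unfolding f_def[abs_def] by measurable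
  qed (auto simp: f_def of_bool_def)
  have "integrable (?M \<Otimes>\<^sub>M ?M) (case_prod f)"
  proof (rule P.Fubini_integrable[OF fm])
    show "integrable ?M (\<lambda>s. LINT t|?M. norm (case (s, t) of (s, t) \<Rightarrow> f s t))"
    proof (rule Bochner_Integration.integrable_bound)
      show "integrable ?M (\<lambda>s. \<bar>v s\<bar> * (LINT t|?M. \<bar>u t\<bar>))" using v by simp
      show "(\<lambda>s. LINT t|?M. norm (case (s, t) of (s, t) \<Rightarrow> f s t)) \<in> borel_measurable ?M"
        using fm by (intro M.borel_measurable_lebesgue_integral) (simp add: case_prod_beta')
      show "AE s in ?M. norm (LINT t|?M. norm (case (s, t) of (s, t) \<Rightarrow> f s t)) \<le> norm (\<bar>v s\<bar> * (LINT t|?M. \<bar>u t\<bar>))"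
      proof (rule AE_I2)
        fix s
        have "(LINT t|?M. \<bar>f s t\<bar>) \<le> (LINT t|?M. \<bar>v s\<bar> * \<bar>u t\<bar>)"
        proof (rule integral_mono)
          show "integrable ?M (\<lambda>t. \<bar>f s t\<bar>)" using fs[of s] by (rule integrable_abs)
        qed (use u in \<open>auto simp: f_def abs_mult of_bool_def\<close>)
        then show "norm (LINT t|?M. norm (case (s, t) of (s, t) \<Rightarrow> f s t)) \<le> norm (\<bar>v s\<bar> * (LINT t|?M. \<bar>u t\<bar>))"
          by simp
      qed
    qed
  qed (use fs in simp)
  then have "(LINT t|?M. (LINT s|?M. f s t)) = (LINT s|?M. (LINT t|?M. f s t))"
    by (rule P.Fubini_integral)
  moreover have "(LINT s|?M. f s t) = (LINT s|?M. indicat_real {..t} s * v s) * u t" for t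
    unfolding f_def ind by (simp flip: mult.assoc)
  moreover have "(LINT t|?M. f s t) = v s * (LINT t|?M. indicat_real {s..} t * u t)" for s
  proof -
    have "f s t = v s * (of_bool (s \<le> t) * u t)" for t by (simp add: f_def)
    then show ?thesis unfolding ind by simp
  qed
  ultimately show "(LINT t|?M. (LINT s|?M. indicat_real {..t} s * v s) * u t)
      = (LINT s|?M. v s * (LINT t|?M. indicat_real {s..} t * u t))"
    by simp
qed

section \<open>Explicit adjoint of the linearised history term\<close>

lemma L2_component:
  fixes v :: "real \<Rightarrow> real ^ 'n"
  assumes "v \<in> L2 T"
  shows "integrable (lebesgue_on {0<..<T}) (\<lambda>t. v t $ i)"
  using integrable_bounded_linear[OF bounded_linear_vec_nth Lp_imp_integrable[OF assms]] by simp

lemma bounded_component_imp_L2: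
  fixes f :: "real \<Rightarrow> real ^ 'n"
  assumes m: "\<And>i. (\<lambda>t. f t $ i) \<in> borel_measurable (lebesgue_on {0<..<T})"
    and b: "\<And>i. AE t in lebesgue_on {0<..<T}. \<bar>f t $ i\<bar> \<le> b i"
  shows "f \<in> L2 T"
proof -
  interpret finite_measure "lebesgue_on {0<..<T}" by (rule finite_measure_lebesgue_on_Ioo)
  have f: "f \<in> borel_measurable (lebesgue_on {0<..<T})"
    by (subst borel_measurable_euclidean_space) (use m in \<open>auto simp: Basis_vec_def inner_axis\<close>)
  have "AE t in lebesgue_on {0<..<T}. \<forall>i\<in>UNIV. \<bar>f t $ i\<bar> \<le> b i"
    by (rule AE_finite_allI) (use b in auto)
  then have "AE t in lebesgue_on {0<..<T}. norm ((norm (f t))\<^sup>2) \<le> (\<Sum>i\<in>UNIV. b i)\<^sup>2"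
  proof eventually_elim
    case (elim t)
    have "norm (f t) \<le> (\<Sum>i\<in>UNIV. \<bar>f t $ i\<bar>)" by (rule norm_le_l1_cart)
    also have "\<dots> \<le> (\<Sum>i\<in>UNIV. b i)" by (intro sum_mono) (use elim in auto)
    finally show ?case by (simp add: power_mono)
  qed
  then have "integrable (lebesgue_on {0<..<T}) (\<lambda>t. (norm (f t))\<^sup>2)"
    by (rule integrable_const_bound) (use f in measurable)
  then show ?thesis using f by (simp add: Lp_def norm_powr_2)
qed

text \<open>Moves the varying domain of integration into an indicator, the form the duality works
  with; the two domains differ only in the point \<open>0\<close>.\<close>

lemma LINT_prefix:
  fixes v :: "real \<Rightarrow> real ^ 'n"
  assumes v: "v \<in> L2 T" and t: "t \<in> {0<..<T}"
  shows "(LINT s|lebesgue_on {0..t}. v s) $ i = (LINT s|lebesgue_on {0<..<T}. indicat_real {..t} s * v s $ i)"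
proof -
  have vi: "integrable (lebesgue_on {0<..<T}) v" by (rule Lp_imp_integrable[OF v]) simp
  then have a: "v absolutely_integrable_on {0..T}"
    by (simp add: integrable_Ioo_iff_absolutely_integrable_Icc)
  have "v absolutely_integrable_on {0..t}"
    by (rule set_integrable_subset[OF a]) (use t in auto)
  then have i: "integrable (lebesgue_on {0..t}) v" by (simp add: integrable_lebesgue_on_iff)
  have "(LINT s|lebesgue_on {0..t}. v s) $ i = (LINT s|lebesgue_on {0..t}. v s $ i)"
    by (rule integral_bounded_linear[OF bounded_linear_vec_nth i, symmetric])
  also have "\<dots> = (LINT s|lebesgue. indicat_real {0..t} s *\<^sub>R v s $ i)"
    by (subst integral_restrict_space) auto
  also have "\<dots> = (LINT s|lebesgue. indicat_real {0<..<T} s *\<^sub>R (indicat_real {..t} s * v s $ i))"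
  proof (rule integral_cong_AE)
    have "AE s in lborel. s \<noteq> (0::real)" by (rule AE_lborel_singleton)
    then have "AE s in lebesgue. s \<noteq> (0::real)" by (rule AE_completion)
    then show "AE s in lebesgue. indicat_real {0..t} s *\<^sub>R v s $ i = indicat_real {0<..<T} s *\<^sub>R (indicat_real {..t} s * v s $ i)"
      by eventually_elim (use t in \<open>auto simp: indicator_def\<close>)
    have i': "integrable (lebesgue_on {0..t}) (\<lambda>s. v s $ i)"
      using integrable_bounded_linear[OF bounded_linear_vec_nth i] by simp
    then have *: "integrable lebesgue (\<lambda>s. indicat_real {0..t} s *\<^sub>R v s $ i)"
      by (simp add: integrable_restrict_space)
    then show "(\<lambda>s. indicat_real {0..t} s *\<^sub>R v s $ i) \<in> borel_measurable lebesgue" by auto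
    have "integrable lebesgue (\<lambda>s. indicat_real {0<..<T} s *\<^sub>R v s $ i)"
      using L2_component[OF v, of i] by (simp add: integrable_restrict_space)
    then have "(\<lambda>s. indicat_real {..t} s * (indicat_real {0<..<T} s *\<^sub>R v s $ i)) \<in> borel_measurable lebesgue"
      by (intro borel_measurable_times borel_measurable_indicator) auto
    then show "(\<lambda>s. indicat_real {0<..<T} s *\<^sub>R (indicat_real {..t} s * v s $ i)) \<in> borel_measurable lebesgue"
      by (simp add: mult.left_commute)
  qed
  also have "\<dots> = (LINT s|lebesgue_on {0<..<T}. indicat_real {..t} s * v s $ i)"
    by (subst integral_restrict_space) auto
  finally show ?thesis .
qed

lemma integrable_indicator_mult:
  fixes f :: "real \<Rightarrow> real"
  assumes f: "integrable (lebesgue_on D) f" and A: "A \<in> sets borel"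
  shows "integrable (lebesgue_on D) (\<lambda>t. indicat_real A t * f t)"
proof (rule Bochner_Integration.integrable_bound[OF f])
  have "indicat_real A \<in> borel_measurable (lebesgue_on D)"
    using A by (intro measurable_restrict_space1 measurable_completion) simp
  then show "(\<lambda>t. indicat_real A t * f t) \<in> borel_measurable (lebesgue_on D)"
    using f by (intro borel_measurable_times) auto
qed (auto simp: indicator_def)

text \<open>\<open>L2_adjoint\<close> is a choice, so an explicit adjoint \<open>B\<close> is
  constructed first to guarantee that the chosen operator is one; testing with the difference of the
  two then shows that they agree. The multiplier \<open>m\<close> stands for the derivative of
  \<open>\<kappa>\<close> along the history.\<close>

lemma Volterra_adjoint_AE:
  fixes m w :: "real \<Rightarrow> real ^ 'n"
  assumes A: "\<And>v t. t \<in> {0<..<T} \<Longrightarrow> v \<in> L2 T \<Longrightarrow> A v t = (\<chi> i. m t $ i * (LINT s|lebesgue_on {0..t}. v s) $ i)"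
    and m: "\<And>i. (\<lambda>t. m t $ i) \<in> borel_measurable (lebesgue_on {0<..<T})"
    and mb: "\<And>t i. \<bar>m t $ i\<bar> \<le> L"
    and w: "w \<in> L2 T"
  shows "L2_adjoint T A w \<in> L2 T"
    and "AE s in lebesgue_on {0<..<T}. \<forall>i. L2_adjoint T A w s $ i
      = (LINT t|lebesgue_on {0<..<T}. indicat_real {s..} t * (m t $ i * w t $ i))"
proof -
  let ?M = "lebesgue_on {0<..<T}"
  interpret finite_measure ?M by (rule finite_measure_lebesgue_on_Ioo)
  \<comment> \<open>The candidate that results from exchanging the order of integration.\<close>
  define B where "B w s = (\<chi> i. LINT t|?M. indicat_real {s..} t * (m t $ i * w t $ i))" for w s
  have mwi: "integrable ?M (\<lambda>t. m t $ i * w t $ i)" if "w \<in> L2 T" for w i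
  proof (rule Bochner_Integration.integrable_bound)
    show "integrable ?M (\<lambda>t. L * w t $ i)" using L2_component[OF that] by simp
    show "(\<lambda>t. m t $ i * w t $ i) \<in> borel_measurable ?M"
      using m L2_component[OF that] by (intro borel_measurable_times) auto
    show "AE t in ?M. norm (m t $ i * w t $ i) \<le> norm (L * w t $ i)"
    proof (rule AE_I2)
      fix t
      show "norm (m t $ i * w t $ i) \<le> norm (L * w t $ i)"
        using mb[of t i] by (auto simp: abs_mult intro!: mult_right_mono)
    qed
  qed
  have Bm: "(\<lambda>s. B w s $ i) \<in> borel_measurable ?M" if "w \<in> L2 T" for w i
    unfolding B_def using Volterra_duality(2)[OF mwi[OF that] mwi[OF that], of i] by simp
  have BL2: "B w \<in> L2 T" if w: "w \<in> L2 T" for w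
  proof (rule bounded_component_imp_L2)
    fix i
    show "(\<lambda>s. B w s $ i) \<in> borel_measurable ?M" by (rule Bm[OF w])
    show "AE s in ?M. \<bar>B w s $ i\<bar> \<le> (LINT t|?M. \<bar>m t $ i * w t $ i\<bar>)"
    proof (rule AE_I2)
      fix s
      have "\<bar>B w s $ i\<bar> \<le> (LINT t|?M. \<bar>indicat_real {s..} t * (m t $ i * w t $ i)\<bar>)"
        unfolding B_def by simp
      also have "\<dots> \<le> (LINT t|?M. \<bar>m t $ i * w t $ i\<bar>)"
      proof (rule integral_mono)
        show "integrable ?M (\<lambda>t. \<bar>m t $ i * w t $ i\<bar>)" using mwi[OF w] by simp
        have "integrable ?M (\<lambda>t. indicat_real {s..} t * (m t $ i * w t $ i))"
          by (rule integrable_indicator_mult[OF mwi[OF w]]) simp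
        then show "integrable ?M (\<lambda>t. \<bar>indicat_real {s..} t * (m t $ i * w t $ i)\<bar>)" by simp
      qed (auto simp: indicator_def)
      finally show "\<bar>B w s $ i\<bar> \<le> (LINT t|?M. \<bar>m t $ i * w t $ i\<bar>)" .
    qed
  qed
  have prod: "integrable ?M (\<lambda>t. f t $ i * g t $ i)" if "f \<in> L2 T" "g \<in> L2 T" for f g :: "real \<Rightarrow> real ^ 'n" and i
  proof (rule Bochner_Integration.integrable_bound)
    show "integrable ?M (\<lambda>t. (norm (f t))\<^sup>2 + (norm (g t))\<^sup>2)"
      using that by (simp add: Lp_def norm_powr_2)
    show "(\<lambda>t. f t $ i * g t $ i) \<in> borel_measurable ?M"
      using L2_component that by (intro borel_measurable_times) auto
    show "AE t in ?M. norm (f t $ i * g t $ i) \<le> norm ((norm (f t))\<^sup>2 + (norm (g t))\<^sup>2)"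
    proof (rule AE_I2)
      fix t
      have "\<bar>f t $ i\<bar> * \<bar>g t $ i\<bar> \<le> norm (f t) * norm (g t)"
        by (intro mult_mono component_le_norm_cart) auto
      also have "\<dots> \<le> (norm (f t))\<^sup>2 + (norm (g t))\<^sup>2"
      proof -
        have "0 \<le> norm (f t) * norm (g t)" by simp
        then show ?thesis using sum_squares_bound[of "norm (f t)" "norm (g t)"] by linarith
      qed
      finally show "norm (f t $ i * g t $ i) \<le> norm ((norm (f t))\<^sup>2 + (norm (g t))\<^sup>2)" by (simp add: abs_mult)
    qed
  qed
  have inner: "L2_inner {0<..<T} f g = (\<Sum>i\<in>UNIV. LINT t|?M. f t $ i * g t $ i)"
    if "f \<in> L2 T" "g \<in> L2 T" for f g :: "real \<Rightarrow> real ^ 'n"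
    unfolding L2_inner_def inner_vec_def using prod[OF that] by simp
  have dual: "L2_inner {0<..<T} (A v) w = L2_inner {0<..<T} v (B w)" if v: "v \<in> L2 T" and w: "w \<in> L2 T" for v w
  proof -
    define V where "V t i = (LINT s|?M. indicat_real {..t} s * v s $ i)" for t i
    have Vb: "\<bar>V t i\<bar> \<le> (LINT s|?M. \<bar>v s $ i\<bar>)" for t i
    proof -
      have "\<bar>V t i\<bar> \<le> (LINT s|?M. \<bar>indicat_real {..t} s * v s $ i\<bar>)"
        unfolding V_def by simp
      also have "\<dots> \<le> (LINT s|?M. \<bar>v s $ i\<bar>)"
      proof (rule integral_mono)
        show "integrable ?M (\<lambda>s. \<bar>v s $ i\<bar>)" using L2_component[OF v] by simp
        have "integrable ?M (\<lambda>s. indicat_real {..t} s * v s $ i)"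
          by (rule integrable_indicator_mult[OF L2_component[OF v]]) simp
        then show "integrable ?M (\<lambda>s. \<bar>indicat_real {..t} s * v s $ i\<bar>)" by simp
      qed (auto simp: indicator_def)
      finally show ?thesis .
    qed
    have Vm: "(\<lambda>t. V t i) \<in> borel_measurable ?M" for i
      unfolding V_def using Volterra_duality(1)[OF L2_component[OF v] L2_component[OF v]] .
    have Av: "A v t $ i = m t $ i * V t i" if "t \<in> {0<..<T}" for t i
      using A[OF that v] LINT_prefix[OF v that] by (simp add: V_def)
    have AvL2: "A v \<in> L2 T"
    proof (rule bounded_component_imp_L2)
      fix i
      have "(\<lambda>t. m t $ i * V t i) \<in> borel_measurable ?M" using m Vm by (rule borel_measurable_times)
      then show "(\<lambda>t. A v t $ i) \<in> borel_measurable ?M"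
        by (rule measurable_cong[THEN iffD2, rotated]) (use Av in simp)
      show "AE t in ?M. \<bar>A v t $ i\<bar> \<le> L * (LINT s|?M. \<bar>v s $ i\<bar>)"
      proof (rule AE_I2)
        fix t assume "t \<in> space ?M"
        then have "\<bar>A v t $ i\<bar> = \<bar>m t $ i\<bar> * \<bar>V t i\<bar>" using Av by (simp add: abs_mult)
        also have "\<dots> \<le> L * (LINT s|?M. \<bar>v s $ i\<bar>)"
          using mb[of t i] Vb[of t i] by (intro mult_mono) auto
        finally show "\<bar>A v t $ i\<bar> \<le> L * (LINT s|?M. \<bar>v s $ i\<bar>)" .
      qed
    qed
    have "(LINT t|?M. A v t $ i * w t $ i) = (LINT t|?M. v t $ i * B w t $ i)" for i
    proof -
      have "(LINT t|?M. A v t $ i * w t $ i) = (LINT t|?M. V t i * (m t $ i * w t $ i))"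
        by (intro Bochner_Integration.integral_cong) (use Av in auto)
      also have "\<dots> = (LINT s|?M. v s $ i * (LINT t|?M. indicat_real {s..} t * (m t $ i * w t $ i)))"
        unfolding V_def by (rule Volterra_duality(3)[OF L2_component[OF v] mwi[OF w]])
      finally show ?thesis by (simp add: B_def)
    qed
    then show ?thesis using inner[OF AvL2 w] inner[OF v BL2[OF w]] by simp
  qed
  \<comment> \<open>\<open>B\<close> witnesses existence, so the chosen operator satisfies the
    defining property too.\<close>
  have spec: "\<forall>w \<in> L2 T. L2_adjoint T A w \<in> L2 T \<and>
      (\<forall>v \<in> L2 T. L2_inner {0<..<T} (A v) w = L2_inner {0<..<T} v (L2_adjoint T A w))"
    unfolding L2_adjoint_def by (rule someI[of _ B]) (use BL2 dual in blast)
  let ?C = "L2_adjoint T A w"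
  show C: "?C \<in> L2 T" using spec w by blast
  \<comment> \<open>The difference serves as its own test function, which makes its squared norm
    zero.\<close>
  have DL2: "(\<lambda>t. ?C t - B w t) \<in> L2 T" by (rule Lp2_diff[OF C BL2[OF w]])
  have eq: "L2_inner {0<..<T} (\<lambda>t. ?C t - B w t) ?C = L2_inner {0<..<T} (\<lambda>t. ?C t - B w t) (B w)"
    using spec w DL2 dual[OF DL2 w] by metis
  have "(LINT t|?M. (norm (?C t - B w t))\<^sup>2) = L2_inner {0<..<T} (\<lambda>t. ?C t - B w t) ?C - L2_inner {0<..<T} (\<lambda>t. ?C t - B w t) (B w)"
  proof -
    have i: "integrable ?M (\<lambda>t. (?C t - B w t) \<bullet> g t)" if "g \<in> L2 T" for g
      unfolding inner_vec_def using prod[OF DL2 that] by simp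
    show ?thesis
      unfolding L2_inner_def power2_norm_eq_inner
      by (subst Bochner_Integration.integral_diff[symmetric]) (auto intro: i C BL2[OF w] simp: inner_diff_right)
  qed
  also have "\<dots> = 0" using eq by simp
  finally have "AE t in ?M. (norm (?C t - B w t))\<^sup>2 = 0"
    using DL2 by (subst (asm) integral_nonneg_eq_0_iff_AE) (auto simp: Lp_def norm_powr_2)
  then show "AE s in ?M. \<forall>i. ?C s $ i = (LINT t|?M. indicat_real {s..} t * (m t $ i * w t $ i))"
  proof eventually_elim
    case (elim s)
    then have "?C s = B w s" by simp
    then show ?case by (simp add: B_def)
  qed
qed

text \<open>Continuous induction: the points where \<open>H\<close> is at least \<open>H a\<close>
  form a compact set, and its largest element could be pushed further to the right unless it were
  \<open>b\<close>.\<close>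

lemma le_if_right_locally_le:
  fixes H :: "real \<Rightarrow> real"
  assumes "a \<le> b" and cont: "continuous_on {a..b} H"
    and right: "\<And>t. a \<le> t \<Longrightarrow> t < b \<Longrightarrow> \<exists>r>0. \<forall>s. t \<le> s \<and> s \<le> t + r \<and> s \<le> b \<longrightarrow> H t \<le> H s"
  shows "H a \<le> H b"
proof -
  define S where "S = {s \<in> {a..b}. H a \<le> H s}"
  have "closed S"
  proof -
    have "S = {a..b} \<inter> H -` {H a..}" by (auto simp: S_def)
    then show ?thesis using continuous_closed_preimage[OF cont, of "{H a..}"] by simp
  qed
  then have "compact S"
    unfolding compact_eq_bounded_closed by (auto simp: S_def intro: bounded_subset[of "{a..b}"])
  moreover have "a \<in> S" using \<open>a \<le> b\<close> by (simp add: S_def)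
  ultimately obtain c where c: "c \<in> S" "\<And>s. s \<in> S \<Longrightarrow> s \<le> c"
    using compact_attains_sup[of S] by blast
  have cab: "a \<le> c" "c \<le> b" "H a \<le> H c" using c(1) by (auto simp: S_def)
  have "c = b"
  proof (rule ccontr)
    assume "c \<noteq> b"
    then have "c < b" using cab by simp
    then obtain r where r: "0 < r" "\<And>s. c \<le> s \<Longrightarrow> s \<le> c + r \<Longrightarrow> s \<le> b \<Longrightarrow> H c \<le> H s"
      using right[OF cab(1)] by blast
    define s where "s = min b (c + r)"
    have s: "c < s" "s \<le> b" "s \<le> c + r" using \<open>c < b\<close> r(1) by (auto simp: s_def)
    then have "s \<in> S" using r(2)[of s] cab by (simp add: S_def)
    then show False using c(2)[of s] s by simp
  qed
  then show ?thesis using cab by simp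
qed

lemma continuous_pos_right:
  fixes f :: "real \<Rightarrow> real"
  assumes "continuous_on {a..b} f" "a \<le> t" "t < b" "0 < f t"
  obtains r where "0 < r" "\<And>u. t \<le> u \<Longrightarrow> u \<le> t + r \<Longrightarrow> u \<le> b \<Longrightarrow> 0 < f u"
proof -
  obtain d where d: "0 < d" "\<And>u. u \<in> {a..b} \<Longrightarrow> dist u t < d \<Longrightarrow> dist (f u) (f t) < f t"
    using assms(1)[unfolded continuous_on_iff, rule_format, of t "f t"] assms by auto
  show thesis
  proof (rule that[of "d / 2"])
    fix u assume "t \<le> u" "u \<le> t + d / 2" "u \<le> b"
    then have "dist (f u) (f t) < f t" using assms d(1) by (intro d(2)) (auto simp: dist_real_def)
    then show "0 < f u" by (auto simp: dist_real_def)
  qed (use d in auto)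
qed

text \<open>
  Formally, this is the equation tested with the sign of \<open>x\<close>. No chain rule for
  \<open>\<bar>x\<bar>\<close> is needed: up to an arbitrarily small linear term, the claimed
  monotonicity holds locally to the right of every point, because \<open>l\<close> vanishes together with \<open>x\<close>.
\<close>
lemma abs_dissipation_estimate:
  fixes x l w :: "real \<Rightarrow> real"
  assumes x: "continuous_on {0..T} x" and l: "l absolutely_integrable_on {0..T}" and w: "w absolutely_integrable_on {0..T}"
    and \<alpha>: "0 \<le> \<alpha>" and K: "0 \<le> K"
    and FTC: "\<And>a b. 0 \<le> a \<Longrightarrow> a \<le> b \<Longrightarrow> b \<le> T \<Longrightarrow> x b - x a = integral {a..b} (\<lambda>t. \<alpha> * l t - w t)"
    and ae: "AE t in lebesgue_on {0<..<T}. 0 \<le> l t * x t \<and> \<bar>l t\<bar> \<le> K * \<bar>x t\<bar>"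
    and a: "0 \<le> a" "a \<le> T"
  shows "\<bar>x a\<bar> + \<alpha> * integral {a..T} (\<lambda>t. \<bar>l t\<bar>) \<le> \<bar>x T\<bar> + integral {a..T} (\<lambda>t. \<bar>w t\<bar>)"
proof -
  have int: "l integrable_on {s..t}" "w integrable_on {s..t}" "(\<lambda>t. \<bar>l t\<bar>) integrable_on {s..t}" "(\<lambda>t. \<bar>w t\<bar>) integrable_on {s..t}"
    if "0 \<le> s" "t \<le> T" for s t
  proof -
    have "l absolutely_integrable_on {s..t}" "w absolutely_integrable_on {s..t}"
      using that by (auto intro: set_integrable_subset[OF l] set_integrable_subset[OF w])
    then show "l integrable_on {s..t}" "w integrable_on {s..t}" "(\<lambda>t. \<bar>l t\<bar>) integrable_on {s..t}" "(\<lambda>t. \<bar>w t\<bar>) integrable_on {s..t}"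
      by (auto simp: absolutely_integrable_on_def)
  qed
  define h where "h t = \<alpha> * \<bar>l t\<bar> - \<bar>w t\<bar>" for t
  have hi: "h integrable_on {s..t}" if "0 \<le> s" "t \<le> T" for s t
    unfolding h_def using int[OF that] by (intro integrable_diff integrable_on_mult_right)
  \<comment> \<open>The slack \<open>\<delta>\<close> pays for the zeros of \<open>x\<close>, around
    which the sign is not constant.\<close>
  have main: "\<bar>x a\<bar> + integral {a..T} h \<le> \<bar>x T\<bar> + \<delta> * (T - a)" if \<delta>: "0 < \<delta>" for \<delta>
  proof -
    define H where "H t = \<bar>x t\<bar> - integral {a..t} h + \<delta> * (t - a)" for t
    have "H a \<le> H T"
    proof (rule le_if_right_locally_le[where H=H and a=a and b=T])
      show "continuous_on {a..T} H"
        unfolding H_def using a hi[of a T]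
        by (intro continuous_intros indefinite_integral_continuous_1 continuous_on_subset[OF x]) auto
      fix t assume t: "a \<le> t" "t < T"
      have step: "H t \<le> H s"
        if "t \<le> s" "s \<le> T" "integral {t..s} h \<le> \<bar>x s\<bar> - \<bar>x t\<bar> + \<delta> * (s - t)" for s
      proof -
        have "integral {a..t} h + integral {t..s} h = integral {a..s} h"
          using that t a by (intro Henstock_Kurzweil_Integration.integral_combine hi) auto
        then show ?thesis using that(3) by (simp add: H_def algebra_simps)
      qed
      show "\<exists>r>0. \<forall>s. t \<le> s \<and> s \<le> t + r \<and> s \<le> T \<longrightarrow> H t \<le> H s"
      proof (cases "x t = 0")
        case True
        \<comment> \<open>Near a zero of \<open>x\<close> the bound \<open>|l| <= K |x|\<close>
          keeps \<open>\<alpha> |l|\<close> below \<open>\<delta>\<close>. A large \<open>K\<close>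
          merely shortens \<open>r\<close>.\<close>
        have "continuous_on {0..T} (\<lambda>u. \<delta> - \<alpha> * K * \<bar>x u\<bar>)" by (intro continuous_intros x)
        then obtain r where r: "0 < r" "\<And>u. t \<le> u \<Longrightarrow> u \<le> t + r \<Longrightarrow> u \<le> T \<Longrightarrow> 0 < \<delta> - \<alpha> * K * \<bar>x u\<bar>"
          using t a \<delta> True by (elim continuous_pos_right[where t=t]) auto
        have "H t \<le> H s" if s: "t \<le> s" "s \<le> t + r" "s \<le> T" for s
        proof (rule step[OF s(1,3)])
          have "integral {t..s} h \<le> integral {t..s} (\<lambda>u. \<delta>)"
          proof (rule integral_le_AE[where T=T])
            show "AE u in lebesgue_on {0<..<T}. u \<in> {t..s} \<longrightarrow> h u \<le> \<delta>"
              using ae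
            proof eventually_elim
              case (elim u)
              show ?case
              proof
                assume u: "u \<in> {t..s}"
                have "h u \<le> \<alpha> * \<bar>l u\<bar>" by (simp add: h_def)
                also have "\<dots> \<le> \<alpha> * (K * \<bar>x u\<bar>)" using elim \<alpha> by (intro mult_left_mono) auto
                also have "\<dots> \<le> \<delta>" using r(2)[of u] u s by (simp add: mult.assoc)
                finally show "h u \<le> \<delta>" .
              qed
            qed
          qed (use s t a hi in auto)
          then show "integral {t..s} h \<le> \<bar>x s\<bar> - \<bar>x t\<bar> + \<delta> * (s - t)"
            using True s by (simp add: mult.commute)
        qed
        then show ?thesis using r(1) by blast
      next
        case False
        \<comment> \<open>The sign persists to the right of \<open>t\<close>, and
          \<open>l x >= 0\<close> turns \<open>\<sigma> l\<close> into \<open>|l|\<close>, so the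
          equation itself can be integrated there.\<close>
        define \<sigma> where "\<sigma> = sgn (x t)"
        have \<sigma>: "0 < \<sigma> * x t" "\<bar>\<sigma>\<bar> = 1" using False by (auto simp: \<sigma>_def sgn_if)
        have "continuous_on {0..T} (\<lambda>u. \<sigma> * x u)" by (intro continuous_intros x)
        then obtain r where r: "0 < r" "\<And>u. t \<le> u \<Longrightarrow> u \<le> t + r \<Longrightarrow> u \<le> T \<Longrightarrow> 0 < \<sigma> * x u"
          using t a \<sigma> by (elim continuous_pos_right[where t=t]) auto
        have abs_x: "\<bar>x u\<bar> = \<sigma> * x u" if "t \<le> u" "u \<le> t + r" "u \<le> T" for u
        proof -
          have "\<bar>x u\<bar> = \<bar>\<sigma> * x u\<bar>" using \<sigma>(2) by (simp add: abs_mult)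
          then show ?thesis using r(2)[OF that] by simp
        qed
        have "H t \<le> H s" if s: "t \<le> s" "s \<le> t + r" "s \<le> T" for s
        proof (rule step[OF s(1,3)])
          have "integral {t..s} h \<le> integral {t..s} (\<lambda>u. \<sigma> * (\<alpha> * l u - w u))"
          proof (rule integral_le_AE[where T=T])
            show "(\<lambda>u. \<sigma> * (\<alpha> * l u - w u)) integrable_on {t..s}"
              using s t a by (intro integrable_diff integrable_on_mult_right int) auto
            show "AE u in lebesgue_on {0<..<T}. u \<in> {t..s} \<longrightarrow> h u \<le> \<sigma> * (\<alpha> * l u - w u)"
              using ae
            proof eventually_elim
              case (elim u)
              show ?case
              proof
                assume u: "u \<in> {t..s}"
                have "0 < \<sigma> * x u" using r(2)[of u] u s by simp
                moreover have "0 \<le> (\<sigma> * l u) * (\<sigma> * x u)"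
                proof -
                  have "(\<sigma> * l u) * (\<sigma> * x u) = (\<sigma> * \<sigma>) * (l u * x u)" by (simp add: algebra_simps)
                  moreover have "0 \<le> (\<sigma> * \<sigma>) * (l u * x u)" using elim by (intro mult_nonneg_nonneg[OF zero_le_square]) simp
                  ultimately show ?thesis by (simp only:)
                qed
                ultimately have "0 \<le> \<sigma> * l u" by (simp add: zero_le_mult_iff)
                moreover have "\<bar>\<sigma> * l u\<bar> = \<bar>l u\<bar>" "\<bar>\<sigma> * w u\<bar> = \<bar>w u\<bar>" using \<sigma>(2) by (auto simp: abs_mult)
                ultimately have "\<sigma> * l u = \<bar>l u\<bar>" "\<sigma> * w u \<le> \<bar>w u\<bar>" by linarith+
                moreover have "\<sigma> * (\<alpha> * l u - w u) = \<alpha> * (\<sigma> * l u) - \<sigma> * w u" by (simp add: algebra_simps)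
                ultimately show "h u \<le> \<sigma> * (\<alpha> * l u - w u)" by (simp add: h_def)
              qed
            qed
          qed (use s t a hi in auto)
          also have "\<dots> = \<sigma> * (x s - x t)" using FTC[of t s] s t a by simp
          also have "\<dots> = \<bar>x s\<bar> - \<bar>x t\<bar>" using abs_x[of s] abs_x[of t] s r(1) t by (simp add: algebra_simps)
          finally show "integral {t..s} h \<le> \<bar>x s\<bar> - \<bar>x t\<bar> + \<delta> * (s - t)"
            using \<delta> s mult_nonneg_nonneg[of \<delta> "s - t"] by linarith
        qed
        then show ?thesis using r(1) by blast
      qed
    qed (fact a(2))
    then show ?thesis by (simp add: H_def)
  qed
  have "\<bar>x a\<bar> + integral {a..T} h \<le> \<bar>x T\<bar>"
  proof (rule field_le_epsilon)
    fix e :: real assume e: "0 < e"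
    \<comment> \<open>The denominator \<open>T + 1\<close> dominates \<open>T - a\<close> and is
      never zero.\<close>
    define \<delta> where "\<delta> = e / (T + 1)"
    have "0 < \<delta>" using e a by (simp add: \<delta>_def)
    have "\<delta> * (T - a) \<le> \<delta> * (T + 1)" using \<open>0 < \<delta>\<close> a by (intro mult_left_mono) auto
    also have "\<dots> = e" using a by (simp add: \<delta>_def)
    finally show "\<bar>x a\<bar> + integral {a..T} h \<le> \<bar>x T\<bar> + e" using main[OF \<open>0 < \<delta>\<close>] by linarith
  qed
  moreover have "integral {a..T} h = \<alpha> * integral {a..T} (\<lambda>t. \<bar>l t\<bar>) - integral {a..T} (\<lambda>t. \<bar>w t\<bar>)"
    unfolding h_def using int[of a T] a
    by (subst Henstock_Kurzweil_Integration.integral_diff) (auto intro: integrable_on_mult_right)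
  ultimately show ?thesis by linarith
qed

text \<open>Look at the maximum of \<open>\<phi>\<close> under an exponential weight: the integral
  term returns at most half of that maximum, which is absorbed and produces the factor 2.\<close>

lemma backward_Gronwall:
  fixes \<phi> :: "real \<Rightarrow> real"
  assumes \<phi>: "continuous_on {0..T} \<phi>" and c: "0 \<le> c" and k: "0 \<le> k"
    and le: "\<And>t. 0 \<le> t \<Longrightarrow> t \<le> T \<Longrightarrow> \<phi> t \<le> c + k * integral {t..T} \<phi>"
    and t: "0 \<le> t" "t \<le> T"
  shows "\<phi> t \<le> 2 * c * exp ((2 * k + 1) * T)"
proof -
  \<comment> \<open>Chosen so that \<open>k / \<gamma> <= 1/2\<close>; the summand 1 keeps
    \<open>\<gamma>\<close> positive for \<open>k = 0\<close>.\<close>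
  define \<gamma> where "\<gamma> = 2 * k + 1"
  have \<gamma>: "0 < \<gamma>" using k by (simp add: \<gamma>_def)
  define g where "g s = \<phi> s * exp (- (\<gamma> * (T - s)))" for s
  have "continuous_on {0..T} g" unfolding g_def by (intro continuous_intros \<phi>)
  then obtain u where u: "u \<in> {0..T}" "\<And>s. s \<in> {0..T} \<Longrightarrow> g s \<le> g u"
    using continuous_attains_sup[of "{0..T}" g] t by auto
  have le_exp: "\<phi> s \<le> g u * exp (\<gamma> * (T - s))" if "s \<in> {0..T}" for s
  proof -
    have "\<phi> s = g s * exp (\<gamma> * (T - s))" by (simp add: g_def exp_minus)
    also have "\<dots> \<le> g u * exp (\<gamma> * (T - s))" using u(2)[OF that] by (intro mult_right_mono) auto
    finally show ?thesis .
  qed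
  \<comment> \<open>At the maximum the hypothesis becomes
    \<open>g u <= c + (k / \<gamma>) g u\<close>; a negative maximum lies below \<open>2 c\<close>
    anyway.\<close>
  have gu: "g u \<le> 2 * c"
  proof (cases "0 \<le> g u")
    case True
    have D: "((\<lambda>s. - exp (\<gamma> * (T - s)) / \<gamma>) has_real_derivative exp (\<gamma> * (T - s))) (at s within S)" for s S
      using \<gamma> by (auto intro!: derivative_eq_intros)
    have I: "((\<lambda>s. exp (\<gamma> * (T - s))) has_integral
        (- exp (\<gamma> * (T - T)) / \<gamma> - - exp (\<gamma> * (T - u)) / \<gamma>)) {u..T}"
      using u D by (intro fundamental_theorem_of_calculus) (auto simp flip: has_real_derivative_iff_has_vector_derivative)
    have "integral {u..T} \<phi> \<le> integral {u..T} (\<lambda>s. g u * exp (\<gamma> * (T - s)))"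
      using u(1) le_exp by (intro integral_le integrable_continuous_real continuous_intros continuous_on_subset[OF \<phi>]) auto
    also have "\<dots> = g u * ((exp (\<gamma> * (T - u)) - 1) / \<gamma>)"
      using integral_unique[OF has_integral_mult_right[OF I, of "g u"]] by (simp add: diff_divide_distrib)
    also have "\<dots> \<le> g u * (exp (\<gamma> * (T - u)) / \<gamma>)"
      using True \<gamma> by (intro mult_left_mono divide_right_mono) auto
    finally have "k * integral {u..T} \<phi> \<le> k * (g u * (exp (\<gamma> * (T - u)) / \<gamma>))"
      using k by (rule mult_left_mono)
    then have "\<phi> u \<le> c + k * (g u * (exp (\<gamma> * (T - u)) / \<gamma>))"
      using le[of u] u(1) by auto
    then have "g u \<le> (c + k * (g u * (exp (\<gamma> * (T - u)) / \<gamma>))) * exp (- (\<gamma> * (T - u)))"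
      unfolding g_def by (intro mult_right_mono) auto
    also have "\<dots> = c * exp (- (\<gamma> * (T - u))) + k / \<gamma> * g u"
    proof -
      have "exp (\<gamma> * (T - u)) * exp (- (\<gamma> * (T - u))) = 1" by (simp flip: exp_add)
      then have "k * (g u * (exp (\<gamma> * (T - u)) / \<gamma>)) * exp (- (\<gamma> * (T - u))) = k / \<gamma> * g u"
        by (simp add: mult.assoc mult.left_commute)
      then show ?thesis by (simp only: distrib_right)
    qed
    also have "\<dots> \<le> c * 1 + 1 / 2 * g u"
    proof (intro add_mono mult_left_mono mult_right_mono)
      show "exp (- (\<gamma> * (T - u))) \<le> 1" using u(1) \<gamma> by simp
      show "k / \<gamma> \<le> 1 / 2" using k by (simp add: \<gamma>_def field_simps)
    qed (use c True in auto)
    finally show ?thesis by simp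
  qed (use c in auto)
  have "\<phi> t \<le> g u * exp (\<gamma> * (T - t))" using le_exp t by simp
  also have "\<dots> \<le> 2 * c * exp (\<gamma> * T)"
    using gu c t \<gamma> by (intro mult_mono) auto
  finally show ?thesis by (simp add: \<gamma>_def)
qed

text \<open>The dissipation estimate for \<open>d - m\<close> and the tail bound on \<open>m\<close>
  show that \<open>\<alpha> \<phi> a\<close> is at most \<open>c\<close> plus \<open>L\<close> times
  the integral of \<open>\<phi>\<close> over \<open>[a,T]\<close>. Backward Gronwall with
  \<open>c / \<alpha>\<close> and \<open>L / \<alpha>\<close> yields \<open>E\<close>; reinserting
  \<open>\<phi> <= E\<close> bounds \<open>x\<close>. The constant \<open>K\<close> appears in
  neither bound.\<close>

lemma scalar_adjoint_bounds:
  fixes x l d m :: "real \<Rightarrow> real"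
  assumes x: "continuous_on {0..T} x" and l: "l absolutely_integrable_on {0..T}"
    and d: "d absolutely_integrable_on {0..T}" and m: "m absolutely_integrable_on {0..T}"
    and \<alpha>: "0 < \<alpha>" and K: "0 \<le> K" and L: "0 \<le> L" and T: "0 \<le> T"
    and FTC: "\<And>a b. 0 \<le> a \<Longrightarrow> a \<le> b \<Longrightarrow> b \<le> T \<Longrightarrow> x b - x a = integral {a..b} (\<lambda>t. \<alpha> * l t - (d t - m t))"
    and ae: "AE t in lebesgue_on {0<..<T}. 0 \<le> l t * x t \<and> \<bar>l t\<bar> \<le> K * \<bar>x t\<bar>"
    and mL: "AE t in lebesgue_on {0<..<T}. \<bar>m t\<bar> \<le> L * integral {t..T} (\<lambda>t. \<bar>l t\<bar>)"
    and c: "\<bar>x T\<bar> + integral {0..T} (\<lambda>t. \<bar>d t\<bar>) \<le> c"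
  defines "E \<equiv> 2 * (c / \<alpha>) * exp ((2 * (L / \<alpha>) + 1) * T)"
  shows "integral {0..T} (\<lambda>t. \<bar>l t\<bar>) \<le> E" and "\<And>t. 0 \<le> t \<Longrightarrow> t \<le> T \<Longrightarrow> \<bar>x t\<bar> \<le> c + L * (T * E)"
proof -
  \<comment> \<open>The mass of \<open>l\<close> still to come, the quantity that obeys a backward
    integral inequality.\<close>
  define \<phi> where "\<phi> t = integral {t..T} (\<lambda>t. \<bar>l t\<bar>)" for t
  have al: "(\<lambda>t. \<bar>l t\<bar>) integrable_on {0..T}" "(\<lambda>t. \<bar>d t\<bar>) integrable_on {0..T}" "(\<lambda>t. \<bar>m t\<bar>) integrable_on {0..T}"
    using l d m by (auto simp: absolutely_integrable_on_def)
  have al': "(\<lambda>t. \<bar>l t\<bar>) integrable_on {s..T}" "(\<lambda>t. \<bar>d t\<bar>) integrable_on {s..T}" "(\<lambda>t. \<bar>m t\<bar>) integrable_on {s..T}" if "0 \<le> s" for s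
    using that by (auto intro: integrable_on_subinterval[OF al(1)] integrable_on_subinterval[OF al(2)] integrable_on_subinterval[OF al(3)])
  have \<phi>0: "0 \<le> \<phi> t" if "0 \<le> t" for t
    unfolding \<phi>_def using al'(1)[OF that] by (intro Henstock_Kurzweil_Integration.integral_nonneg) auto
  have \<phi>c: "continuous_on {0..T} \<phi>"
  proof -
    have "integral {0..T} (\<lambda>t. \<bar>l t\<bar>) - integral {0..t} (\<lambda>t. \<bar>l t\<bar>) = \<phi> t" if "t \<in> {0..T}" for t
      using Henstock_Kurzweil_Integration.integral_combine[of 0 t T "\<lambda>t. \<bar>l t\<bar>"] al(1) that by (simp add: \<phi>_def)
    moreover have "continuous_on {0..T} (\<lambda>t. integral {0..T} (\<lambda>t. \<bar>l t\<bar>) - integral {0..t} (\<lambda>t. \<bar>l t\<bar>))"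
      by (intro continuous_on_diff continuous_on_const indefinite_integral_continuous_1 al)
    ultimately show ?thesis by (rule continuous_on_eq[rotated])
  qed
  have \<phi>i: "\<phi> integrable_on {s..T}" if "0 \<le> s" for s
    by (rule integrable_continuous_real[OF continuous_on_subset[OF \<phi>c]]) (use that in auto)
  have w: "(\<lambda>t. d t - m t) absolutely_integrable_on {0..T}" using d m by (rule set_integral_diff)
  have main: "\<bar>x a\<bar> + \<alpha> * \<phi> a \<le> c + L * integral {a..T} \<phi>" if a: "0 \<le> a" "a \<le> T" for a
  proof -
    have "\<bar>x a\<bar> + \<alpha> * \<phi> a \<le> \<bar>x T\<bar> + integral {a..T} (\<lambda>t. \<bar>d t - m t\<bar>)"
      unfolding \<phi>_def by (rule abs_dissipation_estimate[OF x l w _ K FTC ae a]) (use \<alpha> in auto)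
    also have "integral {a..T} (\<lambda>t. \<bar>d t - m t\<bar>) \<le> integral {a..T} (\<lambda>t. \<bar>d t\<bar> + L * \<phi> t)"
    proof (rule integral_le_AE[where T=T])
      have "(\<lambda>t. \<bar>d t - m t\<bar>) integrable_on {0..T}" using w by (simp add: absolutely_integrable_on_def)
      then show "(\<lambda>t. \<bar>d t - m t\<bar>) integrable_on {a..T}"
        by (rule integrable_on_subinterval) (use a in auto)
      show "(\<lambda>t. \<bar>d t\<bar> + L * \<phi> t) integrable_on {a..T}"
        using a by (intro integrable_add integrable_on_mult_right al' \<phi>i)
      show "AE t in lebesgue_on {0<..<T}. t \<in> {a..T} \<longrightarrow> \<bar>d t - m t\<bar> \<le> \<bar>d t\<bar> + L * \<phi> t"
        using mL
      proof eventually_elim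
        case (elim t)
        then show ?case using abs_triangle_ineq4[of "d t" "m t"] by (auto simp: \<phi>_def)
      qed
    qed (use a in auto)
    also have "\<dots> = integral {a..T} (\<lambda>t. \<bar>d t\<bar>) + L * integral {a..T} \<phi>"
      using a by (subst Henstock_Kurzweil_Integration.integral_add) (auto intro!: integrable_on_mult_right al' \<phi>i)
    also have "integral {a..T} (\<lambda>t. \<bar>d t\<bar>) \<le> integral {0..T} (\<lambda>t. \<bar>d t\<bar>)"
      using a al al' by (intro integral_subset_le) auto
    finally show ?thesis using c by linarith
  qed
  have d0: "0 \<le> integral {0..T} (\<lambda>t. \<bar>d t\<bar>)"
    using al(2) by (intro Henstock_Kurzweil_Integration.integral_nonneg) auto
  have c0: "0 \<le> c" using c d0 by linarith
  have \<phi>E: "\<phi> t \<le> E" if t: "0 \<le> t" "t \<le> T" for t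
    unfolding E_def
  proof (rule backward_Gronwall[OF \<phi>c])
    fix t assume "0 \<le> t" "t \<le> T"
    then have "\<alpha> * \<phi> t \<le> c + L * integral {t..T} \<phi>" using main[of t] abs_ge_zero[of "x t"] by linarith
    then show "\<phi> t \<le> c / \<alpha> + L / \<alpha> * integral {t..T} \<phi>" using \<alpha> by (simp add: field_simps)
  qed (use c0 L \<alpha> t in auto)
  then show "integral {0..T} (\<lambda>t. \<bar>l t\<bar>) \<le> E" using T by (simp add: \<phi>_def)
  show "\<bar>x t\<bar> \<le> c + L * (T * E)" if t: "0 \<le> t" "t \<le> T" for t
  proof -
    have "integral {t..T} \<phi> \<le> integral {t..T} (\<lambda>t. E)"
      using t \<phi>E \<phi>i by (intro integral_le) auto
    also have "\<dots> = (T - t) * E" using t by simp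
    also have "\<dots> \<le> T * E" using t \<phi>0[of 0] \<phi>E[of 0] T by (intro mult_right_mono) auto
    finally have "L * integral {t..T} \<phi> \<le> L * (T * E)" using L by (intro mult_left_mono)
    moreover have "0 \<le> \<alpha> * \<phi> t" using \<phi>0[OF t(1)] \<alpha> by simp
    ultimately show ?thesis using main[OF t] by linarith
  qed
qed

section \<open>The uniform bounds\<close>

lemma Linf_imp_L2:
  fixes f :: "real \<Rightarrow> 'a::euclidean_space"
  assumes "f \<in> Linf {0<..<T}"
  shows "f \<in> L2 T"
proof -
  interpret finite_measure "lebesgue_on {0<..<T}" by (rule finite_measure_lebesgue_on_Ioo)
  have f: "f \<in> borel_measurable (lebesgue_on {0<..<T})" "Linf_norm {0<..<T} f < \<infinity>"
    using assms by (auto simp: Linf_def)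
  then obtain c where c: "Linf_norm {0<..<T} f \<le> ereal c"
    by (cases "Linf_norm {0<..<T} f") auto
  have "AE t in lebesgue_on {0<..<T}. ereal (norm (f t)) \<le> Linf_norm {0<..<T} f"
    unfolding Linf_norm_def by (rule esssup_AE)
  then have "AE t in lebesgue_on {0<..<T}. norm ((norm (f t))\<^sup>2) \<le> c\<^sup>2"
  proof eventually_elim
    case (elim t)
    then have "ereal (norm (f t)) \<le> ereal c" using c by (rule order_trans)
    then show ?case by (simp add: power_mono)
  qed
  then have "integrable (lebesgue_on {0<..<T}) (\<lambda>t. (norm (f t))\<^sup>2)"
    by (rule integrable_const_bound) (use f in measurable)
  then show ?thesis using f by (simp add: Lp_def norm_powr_2)
qed

lemma hist_measurable:
  fixes q :: "real \<Rightarrow> real ^ 'n"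
  assumes "q \<in> L2 T"
  shows "(\<lambda>t. hist y0 q t $ i) \<in> borel_measurable (lebesgue_on {0<..<T})"
proof -
  have "integrable (lebesgue_on {0<..<T}) q" by (rule Lp_imp_integrable[OF assms]) simp
  then have "integrable (lebesgue_on {0..T}) q"
    by (simp add: integrable_Ioo_iff_absolutely_integrable_Icc integrable_lebesgue_on_iff)
  then have "continuous_on {0..T} (\<lambda>t. integral\<^sup>L (lebesgue_on {0..t}) q)"
    by (rule indefinite_integral_continuous_real)
  then have "continuous_on {0<..<T} (\<lambda>t. integral\<^sup>L (lebesgue_on {0..t}) q)"
    by (rule continuous_on_subset) auto
  then have "continuous_on {0<..<T} (\<lambda>t. hist y0 q t $ i)"
    unfolding hist_def by (intro continuous_on_component continuous_intros)
  then show ?thesis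
    by (rule continuous_imp_measurable_on_sets_lebesgue) simp
qed

text \<open>Since \<open>\<kappa>\<close> acts componentwise, the adjoint of its linearisation does
  too, and the scalar estimate applies to each component with \<open>K = 1 / e\<close>. The constant
  \<open>c\<close> collects the terminal value and the bound of the \<open>L1\<close> norm of
  \<open>dj q\<close> by its squared \<open>L2\<close> norm; \<open>E\<close> depends on
  \<open>e\<close> at most through \<open>c\<close>.\<close>

lemma adjoint_bounds:
  fixes q xi lam :: "real \<Rightarrow> real ^ 'n"
  assumes T: "0 < T" and \<alpha>: "0 < \<alpha>" and e: "0 < e"
    and lip: "L-lipschitz_on UNIV \<kappa>" and diff: "\<And>x. \<kappa> field_differentiable at x"
    and q: "state_eps T \<alpha> \<kappa> y0 e l = q" "q \<in> L2 T" and dj: "dj q \<in> L2 T"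
    and adj: "adjoint_system T \<alpha> \<kappa> y0 dj qd lbar e l xi lam"
    and c: "\<bar>q T $ i - qd $ i\<bar> + (T + (LINT t|lebesgue_on {0<..<T}. (norm (dj q t))\<^sup>2)) \<le> c"
  defines "E \<equiv> 2 * (c / \<alpha>) * exp ((2 * (L / \<alpha>) + 1) * T)"
  shows "(\<lambda>t. lam t $ i) absolutely_integrable_on {0..T}"
    and "integral {0..T} (\<lambda>t. \<bar>lam t $ i\<bar>) \<le> E"
    and "\<And>t. 0 \<le> t \<Longrightarrow> t \<le> T \<Longrightarrow> \<bar>xi t $ i\<bar> \<le> c + L * (T * E)"
proof -
  let ?M = "lebesgue_on {0<..<T}"
  define A where "A = kappa_hist_deriv \<kappa> y0 q"
  define m where "m t = (\<chi> i. deriv \<kappa> (hist y0 q t $ i))" for t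
  define z where "z t = - \<alpha> *\<^sub>R q t + l t - cw \<kappa> (hist y0 q t)" for t
  have xi: "xi \<in> W1 T 2" and lamL: "lam \<in> Linf {0<..<T}"
    and eq: "AE t in ?M. - time_deriv T xi t + \<alpha> *\<^sub>R lam t + L2_adjoint T A lam t = dj q t"
    and xiT: "xi T = q T - qd"
    and sgn: "AE t in ?M.
            (z t $ i \<noteq> 0 \<longrightarrow> lam t $ i = 1 / e * indicator {s. z s $ i > 0} t * xi t $ i) \<and>
            (z t $ i = 0 \<longrightarrow> 0 \<le> lam t $ i \<and> lam t $ i \<le> 1 / e * xi t $ i)"
    using adj unfolding adjoint_system_def Let_def q(1) A_def z_def by blast+
  have lam: "lam \<in> L2 T" by (rule Linf_imp_L2[OF lamL])
  have ai: "(\<lambda>t. f t $ i) absolutely_integrable_on {0..T}" if "f \<in> L2 T" for f :: "real \<Rightarrow> real ^ 'n"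
    using L2_component[OF that] by (simp add: integrable_Ioo_iff_absolutely_integrable_Icc)
  show lami: "(\<lambda>t. lam t $ i) absolutely_integrable_on {0..T}" by (rule ai[OF lam])
  have mm: "(\<lambda>t. m t $ i) \<in> borel_measurable ?M" for i
    unfolding m_def
    using measurable_compose[OF hist_measurable[OF q(2)] lipschitz_deriv_bound(2)[OF lip diff]] by simp
  have mb: "\<bar>m t $ i\<bar> \<le> L" for t i
    unfolding m_def using lipschitz_deriv_bound(1)[OF lip diff] by simp
  have Aeq: "A v t = (\<chi> i. m t $ i * (LINT s|lebesgue_on {0..t}. v s) $ i)" for v t
    by (simp add: A_def kappa_hist_deriv_def m_def)
  note adjoint = Volterra_adjoint_AE[where A=A, OF Aeq mm mb lam]
  let ?C = "L2_adjoint T A lam"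
  have L: "0 \<le> L" using lip by (rule lipschitz_on_nonneg)
  have labs: "(\<lambda>t. \<bar>lam t $ i\<bar>) absolutely_integrable_on {0..T}"
    using absolutely_integrable_norm[OF lami] by (simp add: o_def)
  have djabs: "(\<lambda>t. \<bar>dj q t $ i\<bar>) absolutely_integrable_on {0..T}"
    using absolutely_integrable_norm[OF ai[OF dj]] by (simp add: o_def)
  have 1: "continuous_on {0..T} (\<lambda>t. xi t $ i)"
    using xi by (intro continuous_on_component) (simp add: W1_def)
  have 2: "xi b $ i - xi a $ i = integral {a..b} (\<lambda>t. \<alpha> * lam t $ i - (dj q t $ i - ?C t $ i))"
    if ab: "0 \<le> a" "a \<le> b" "b \<le> T" for a b
  proof -
    let ?f = "\<lambda>t. time_deriv T xi t $ i" and ?g = "\<lambda>t. \<alpha> * lam t $ i - (dj q t $ i - ?C t $ i)"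
    have "?f absolutely_integrable_on {0..T}" by (rule W1_FTC_component[OF xi]) simp
    then have fi: "?f integrable_on {a..b}"
      by (intro integrable_on_subinterval[OF set_lebesgue_integral_eq_integral(1)]) (use ab in auto)
    have "?g integrable_on {0..T}"
      by (intro integrable_diff integrable_on_mult_right set_lebesgue_integral_eq_integral(1) ai lam dj adjoint(1))
    then have gi: "?g integrable_on {a..b}"
      by (rule integrable_on_subinterval) (use ab in auto)
    have eqi: "AE t in ?M. ?f t = ?g t"
      using eq
    proof eventually_elim
      case (elim t)
      then have "(- time_deriv T xi t + \<alpha> *\<^sub>R lam t + ?C t) $ i = dj q t $ i" by simp
      then show ?case by simp
    qed
    \<comment> \<open>The integrands agree only almost everywhere on the open interval, hence a
      comparison in both directions.\<close>
    have "integral {a..b} ?f \<le> integral {a..b} ?g"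
      by (rule integral_le_AE[OF fi gi ab(1,3)]) (use eqi in eventually_elim, simp)
    moreover have "integral {a..b} ?g \<le> integral {a..b} ?f"
      by (rule integral_le_AE[OF gi fi ab(1,3)]) (use eqi in eventually_elim, simp)
    ultimately show ?thesis using W1_FTC_component(2)[OF xi _ ab] by simp
  qed
  \<comment> \<open>Where \<open>z\<close> vanishes, the chain \<open>0 <= lam <= xi / e\<close>
    itself forces \<open>xi >= 0\<close>; elsewhere \<open>lam\<close> is either zero or
    \<open>xi / e\<close>.\<close>
  have 3: "AE t in ?M. 0 \<le> lam t $ i * xi t $ i \<and> \<bar>lam t $ i\<bar> \<le> 1 / e * \<bar>xi t $ i\<bar>"
    using sgn
  proof eventually_elim
    case (elim t)
    show ?case
    proof (cases "z t $ i = 0")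
      case True
      with elim have le: "0 \<le> lam t $ i" "lam t $ i \<le> 1 / e * xi t $ i" by auto
      then have "0 \<le> 1 / e * xi t $ i" by linarith
      then have "0 \<le> xi t $ i" using e by (simp add: zero_le_divide_iff)
      then show ?thesis using le by simp
    next
      case False
      with elim have "lam t $ i = 1 / e * indicator {s. z s $ i > 0} t * xi t $ i" by simp
      then show ?thesis using e by (auto simp: indicator_def abs_mult)
    qed
  qed
  \<comment> \<open>The adjoint at time \<open>t\<close> sees only times after \<open>t\<close>, so
    the remaining mass of the multiplier bounds it.\<close>
  have 4: "AE t in ?M. \<bar>?C t $ i\<bar> \<le> L * integral {t..T} (\<lambda>t. \<bar>lam t $ i\<bar>)"
  proof -
    have "AE t in ?M. t \<in> {0<..<T}" by (rule AE_I2) simp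
    with adjoint(2) show ?thesis
    proof eventually_elim
      case (elim t)
      have li: "integrable ?M (\<lambda>u. \<bar>lam u $ i\<bar>)" using L2_component[OF lam] by simp
      have "\<bar>?C t $ i\<bar> = \<bar>LINT u|?M. indicat_real {t..} u * (m u $ i * lam u $ i)\<bar>"
        using elim(1) by simp
      also have "\<dots> \<le> (LINT u|?M. \<bar>indicat_real {t..} u * (m u $ i * lam u $ i)\<bar>)"
        by (rule integral_abs_bound)
      also have "\<dots> \<le> (LINT u|?M. L * (indicat_real {t..} u * \<bar>lam u $ i\<bar>))"
      proof (rule integral_mono')
        show "integrable ?M (\<lambda>u. L * (indicat_real {t..} u * \<bar>lam u $ i\<bar>))"
          by (intro integrable_mult_right integrable_indicator_mult li) simp
        fix u
        have "\<bar>m u $ i\<bar> * \<bar>lam u $ i\<bar> \<le> L * \<bar>lam u $ i\<bar>" by (intro mult_right_mono mb) simp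
        then show "\<bar>indicat_real {t..} u * (m u $ i * lam u $ i)\<bar> \<le> L * (indicat_real {t..} u * \<bar>lam u $ i\<bar>)"
          by (simp add: indicator_def abs_mult)
        show "0 \<le> L * (indicat_real {t..} u * \<bar>lam u $ i\<bar>)" using L by simp
      qed
      also have "\<dots> = L * (LINT u|?M. indicat_real {t..} u * \<bar>lam u $ i\<bar>)" by simp
      also have "(LINT u|?M. indicat_real {t..} u * \<bar>lam u $ i\<bar>) = (LINT u|lebesgue_on {t..<T}. \<bar>lam u $ i\<bar>)"
        using elim(2)
        by (subst (1 2) integral_restrict_space)
          (auto intro!: Bochner_Integration.integral_cong simp: indicator_def)
      also have "\<dots> = integral {t..<T} (\<lambda>u. \<bar>lam u $ i\<bar>)"
      proof (rule lebesgue_integral_eq_integral)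
        have "(\<lambda>u. \<bar>lam u $ i\<bar>) absolutely_integrable_on {t..<T}"
          by (rule set_integrable_subset[OF labs]) (use elim(2) in auto)
        then show "integrable (lebesgue_on {t..<T}) (\<lambda>u. \<bar>lam u $ i\<bar>)"
          by (simp add: integrable_lebesgue_on_iff)
      qed simp
      also have "\<dots> = integral {t..T} (\<lambda>u. \<bar>lam u $ i\<bar>)"
        by (rule integral_spike_set; rule negligible_subset[of "{T}"]; auto)
      finally show ?case .
    qed
  qed
  have 5: "\<bar>xi T $ i\<bar> + integral {0..T} (\<lambda>t. \<bar>dj q t $ i\<bar>) \<le> c"
  proof -
    have "integral {0..T} (\<lambda>t. \<bar>dj q t $ i\<bar>) = (LINT t|?M. \<bar>dj q t $ i\<bar>)"
      by (rule LINT_Ioo_eq_integral[OF djabs, symmetric])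
    also have "\<dots> \<le> (LINT t|?M. norm (dj q t))"
      using L2_component[OF dj] Lp_imp_integrable[OF dj] by (intro integral_mono) (auto simp: component_le_norm_cart)
    also have "\<dots> \<le> T + (LINT t|?M. (norm (dj q t))\<^sup>2)"
      by (rule L2_integrable_norm_le[OF dj]) (use T in simp)
    finally show ?thesis using c by (simp add: xiT)
  qed
  have Ke: "0 \<le> 1 / e" using e by simp
  note bounds = scalar_adjoint_bounds[OF 1 lami ai[OF dj] ai[OF adjoint(1)] \<alpha> Ke L less_imp_le[OF T] 2 3 4 5]
  show "integral {0..T} (\<lambda>t. \<bar>lam t $ i\<bar>) \<le> E" unfolding E_def by (rule bounds(1))
  show "\<bar>xi t $ i\<bar> \<le> c + L * (T * E)" if "0 \<le> t" "t \<le> T" for t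
    unfolding E_def by (rule bounds(2)) (use that in auto)
qed

text \<open>Elements of the unit ball of \<open>W10 T 1\<close> are bounded by one pointwise, so the
  dual norm is at most the sum of the \<open>L1\<close> norms of the components.\<close>

lemma Wm1inf_norm_le:
  fixes lam :: "real \<Rightarrow> real ^ 'n"
  assumes ai: "\<And>i. (\<lambda>t. lam t $ i) absolutely_integrable_on {0..T}"
    and le: "\<And>i. integral {0..T} (\<lambda>t. \<bar>lam t $ i\<bar>) \<le> E"
  shows "Wm1inf_norm T (as_functional T lam) \<le> ereal (real CARD('n) * E)"
  unfolding Wm1inf_norm_def
proof (rule SUP_least)
  let ?M = "lebesgue_on {0<..<T}"
  fix v :: "real \<Rightarrow> real ^ 'n" assume "v \<in> {v \<in> W10 T 1. W11_norm T v \<le> 1}"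
  then have v: "v \<in> W10 T 1" "W11_norm T v \<le> 1" by auto
  have vb: "\<bar>v t $ i\<bar> \<le> 1" if "t \<in> {0<..<T}" for t i
    using component_le_norm_cart[of "v t" i] W10_norm_le_W11_norm[OF v(1), of t] v(2) that by auto
  have abs: "(\<lambda>t. \<bar>lam t $ i\<bar>) absolutely_integrable_on {0..T}" for i
    using absolutely_integrable_norm[OF ai[of i]] by (simp add: o_def)
  then have int: "integrable ?M (\<lambda>t. \<bar>lam t $ i\<bar>)" for i
    by (simp only: integrable_Ioo_iff_absolutely_integrable_Icc)
  have "\<bar>as_functional T lam v\<bar> \<le> (LINT t|?M. \<bar>lam t \<bullet> v t\<bar>)"
    unfolding as_functional_def by (rule integral_abs_bound)
  also have "\<dots> \<le> (LINT t|?M. (\<Sum>i\<in>UNIV. \<bar>lam t $ i\<bar>))"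
  proof (rule integral_mono')
    show "integrable ?M (\<lambda>t. \<Sum>i\<in>UNIV. \<bar>lam t $ i\<bar>)" by (intro Bochner_Integration.integrable_sum int)
    fix t assume "t \<in> space ?M"
    then have t: "t \<in> {0<..<T}" by simp
    have "\<bar>lam t \<bullet> v t\<bar> \<le> (\<Sum>i\<in>UNIV. \<bar>lam t $ i * v t $ i\<bar>)"
      unfolding inner_vec_def inner_real_def by (rule sum_abs)
    also have "\<dots> \<le> (\<Sum>i\<in>UNIV. \<bar>lam t $ i\<bar>)"
      using vb[OF t] by (intro sum_mono) (simp add: abs_mult mult_left_le)
    finally show "\<bar>lam t \<bullet> v t\<bar> \<le> (\<Sum>i\<in>UNIV. \<bar>lam t $ i\<bar>)" .
  qed (simp add: sum_nonneg)
  also have "\<dots> = (\<Sum>i\<in>UNIV. integral {0..T} (\<lambda>t. \<bar>lam t $ i\<bar>))"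
    using int by (simp add: LINT_Ioo_eq_integral[OF abs])
  also have "\<dots> \<le> (\<Sum>i\<in>(UNIV :: 'n set). E)" by (intro sum_mono le)
  finally show "ereal \<bar>as_functional T lam v\<bar> \<le> ereal (real CARD('n) * E)" by simp
qed

lemma Linf_norm_le:
  fixes f :: "real \<Rightarrow> real ^ 'n"
  assumes "f \<in> borel_measurable (lebesgue_on D)" and "\<And>t i. t \<in> D \<Longrightarrow> \<bar>f t $ i\<bar> \<le> E"
  shows "Linf_norm D f \<le> ereal (real CARD('n) * E)"
  unfolding Linf_norm_def
proof (rule esssup_I)
  show "(\<lambda>t. ereal (norm (f t))) \<in> borel_measurable (lebesgue_on D)"
    using assms(1) by measurable
  show "AE t in lebesgue_on D. ereal (norm (f t)) \<le> ereal (real CARD('n) * E)"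
  proof (rule AE_I2)
    fix t assume "t \<in> space (lebesgue_on D)"
    have "norm (f t) \<le> (\<Sum>i\<in>UNIV. \<bar>f t $ i\<bar>)" by (rule norm_le_l1_cart)
    also have "\<dots> \<le> (\<Sum>i\<in>(UNIV :: 'n set). E)"
      by (intro sum_mono assms(2)) (use \<open>t \<in> space (lebesgue_on D)\<close> in simp)
    finally show "ereal (norm (f t)) \<le> ereal (real CARD('n) * E)" by simp
  qed
qed

theorem proposition3p6:
  fixes T \<alpha> :: real
    and \<kappa> :: "real \<Rightarrow> real"
    and y0 qd :: "real ^ 'n"
    and j :: "(real \<Rightarrow> real ^ 'n) \<Rightarrow> real"
    and dj :: "(real \<Rightarrow> real ^ 'n) \<Rightarrow> (real \<Rightarrow> real ^ 'n)"
    and lbar :: "real \<Rightarrow> real ^ 'n"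
    and eps :: "nat \<Rightarrow> real"
    and l xi lam :: "nat \<Rightarrow> real \<Rightarrow> real ^ 'n"
  assumes "T > 0" and "\<alpha> > 0"
    and kappa_nonneg: "\<And>x. \<kappa> x \<ge> 0"
    and kappa_lipschitz: "\<exists>L. L-lipschitz_on UNIV \<kappa>"
    and kappa_diff: "\<And>x. \<kappa> field_differentiable at x"
    and kappa_deriv: "deriv \<kappa> \<in> W1p UNIV 2"
    and j_C1: "L2_C1 T j dj"
    and qd_nonneg: "\<And>i. qd $ i \<ge> 0"
    and solvable: "\<And>m. m \<in> H10 T \<Longrightarrow> uniquely_solvable T \<alpha> y0 (dissip \<kappa>) m"
    and solvable_eps: "\<And>e m. e > 0 \<Longrightarrow> m \<in> L2 T \<Longrightarrow> uniquely_solvable T \<alpha> y0 (dissip_eps \<kappa> e) m"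
    and lbar_opt: "local_min T (cost T \<alpha> \<kappa> y0 j qd) lbar"
    and eps_pos: "\<And>k. eps k > 0" and eps_lim: "eps \<longlonglongrightarrow> 0"
    and l_opt: "\<And>k. local_min T (cost_eps T \<alpha> \<kappa> y0 j qd lbar (eps k)) (l k)"
    and l_conv: "(\<lambda>k. H1_norm T (\<lambda>t. l k t - lbar t)) \<longlonglongrightarrow> 0"
    and adj: "\<And>k. adjoint_system T \<alpha> \<kappa> y0 dj qd lbar (eps k) (l k) (xi k) (lam k)"
  shows "\<exists>C>0. \<forall>k. Wm1inf_norm T (as_functional T (lam k)) \<le> ereal C \<and>
                   Linf_norm {0<..<T} (xi k) \<le> ereal C"
proof -
  obtain L where lip: "L-lipschitz_on UNIV \<kappa>" using kappa_lipschitz by blast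
  have L: "0 \<le> L" using lip by (rule lipschitz_on_nonneg)
  have lH: "l k \<in> H10 T" "lbar \<in> H10 T" for k
    using l_opt lbar_opt by (auto simp: local_min_def)
  have H10_L2: "u \<in> L2 T" if "u \<in> H10 T" for u :: "real \<Rightarrow> real ^ 'n"
    using that by (auto simp: W10_def W1_def W1p_def)
  \<comment> \<open>Norm convergence is turned into a uniform bound on the distances to
    \<open>lbar\<close>.\<close>
  obtain N where N: "\<And>k. \<bar>H1_norm T (\<lambda>t. l k t - lbar t)\<bar> \<le> N"
    using convergent_imp_Bseq[OF convergentI[OF l_conv]] by (auto simp: Bseq_def)
  \<comment> \<open>A pointwise bound for all loads: the first bracket covers the distance to
    \<open>lbar\<close>, the second \<open>lbar\<close> itself.\<close>
  define M where "M = (T + N\<^sup>2) + (T + (H1_norm T lbar)\<^sup>2)"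
  have M0: "0 \<le> M" using \<open>T > 0\<close> by (simp add: M_def)
  have lM: "l k t $ i \<le> M" if "t \<in> {0..T}" for k t i
  proof -
    have "norm (l k t - lbar t) \<le> T + (H1_norm T (\<lambda>t. l k t - lbar t))\<^sup>2"
      by (rule H10_norm_le[OF H10_diff[OF lH] that])
    also have "\<dots> \<le> T + N\<^sup>2"
      using N[of k] by (simp add: abs_le_square_iff[symmetric])
    finally have "norm (l k t) \<le> (T + N\<^sup>2) + norm (lbar t)"
      using norm_triangle_sub[of "l k t" "lbar t"] by linarith
    then show ?thesis
      using H10_norm_le[OF lH(2) that] component_le_norm_cart[of "l k t" i] by (simp add: M_def)
  qed
  define q where "q k = state_eps T \<alpha> \<kappa> y0 (eps k) (l k)" for k
  have sol: "solves T \<alpha> y0 (dissip_eps \<kappa> (eps k)) (l k) (q k)" for k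
  proof -
    have "\<exists>q. solves T \<alpha> y0 (dissip_eps \<kappa> (eps k)) (l k) q"
      using solvable_eps[OF eps_pos H10_L2[OF lH(1)]] by (simp add: uniquely_solvable_def)
    then show ?thesis unfolding q_def state_eps_def by (rule someI_ex)
  qed
  have qH: "q k \<in> H10 T" for k using sol by (simp add: solves_def)
  note q_bounds = state_eps_bounds[OF \<open>\<alpha> > 0\<close> eps_pos kappa_nonneg M0 sol lM]
  \<comment> \<open>Monotonicity from the zero initial value supplies the lower bound 0.\<close>
  have qb: "\<bar>q k t $ i\<bar> \<le> M / \<alpha>" if "0 \<le> t" "t \<le> T" for k i t
  proof -
    have "q k 0 $ i = 0" using qH[of k] by (simp add: W10_def)
    then show ?thesis using q_bounds(1)[of 0 t k i] q_bounds(2)[of t k i] that by simp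
  qed
  \<comment> \<open>The states are monotone with one bound for all \<open>eps k\<close>, so
    \<open>dj\<close> is bounded along them.\<close>
  obtain B where B: "\<And>k. (LINT t|lebesgue_on {0<..<T}. (norm (dj (q k) t))\<^sup>2) \<le> B"
  proof (rule L2_C1_bounded_on_monotone[OF j_C1, of q "M / \<alpha>"])
    show "continuous_on {0..T} (q k)" for k using qH[of k] by (simp add: W10_def W1_def)
  qed (use \<open>T > 0\<close> H10_L2[OF qH] q_bounds(1) qb in auto)
  \<comment> \<open>\<open>M / \<alpha>\<close> bounds the final state, the sum bounds any component
    of the target, and \<open>T + B\<close> bounds the \<open>L1\<close> norm of
    \<open>dj\<close>.\<close>
  define c where "c = (M / \<alpha> + (\<Sum>i\<in>UNIV. \<bar>qd $ i\<bar>)) + (T + B)"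
  have c: "\<bar>q k T $ i - qd $ i\<bar> + (T + (LINT t|lebesgue_on {0<..<T}. (norm (dj (q k) t))\<^sup>2)) \<le> c" for k i
  proof -
    have "\<bar>qd $ i\<bar> \<le> (\<Sum>i\<in>UNIV. \<bar>qd $ i\<bar>)" by (rule member_le_sum) auto
    then show ?thesis
      using qb[of T k i] B[of k] \<open>T > 0\<close> abs_triangle_ineq4[of "q k T $ i" "qd $ i"]
      unfolding c_def by linarith
  qed
  define E where "E = 2 * (c / \<alpha>) * exp ((2 * (L / \<alpha>) + 1) * T)"
  have dj: "dj (q k) \<in> L2 T" for k using j_C1 H10_L2[OF qH] by (simp add: L2_C1_def)
  note bounds = adjoint_bounds[OF \<open>T > 0\<close> \<open>\<alpha> > 0\<close> eps_pos lip kappa_diff q_def[symmetric] H10_L2[OF qH] dj adj c,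
      folded E_def]
  have 1: "Wm1inf_norm T (as_functional T (lam k)) \<le> ereal (real CARD('n) * E)" for k
    by (rule Wm1inf_norm_le[OF bounds(1,2)])
  have 2: "Linf_norm {0<..<T} (xi k) \<le> ereal (real CARD('n) * (c + L * (T * E)))" for k
  proof (rule Linf_norm_le)
    have "xi k \<in> W1 T 2" using adj[of k] by (simp add: adjoint_system_def Let_def)
    then show "xi k \<in> borel_measurable (lebesgue_on {0<..<T})" by (simp add: W1_def W1p_def Lp_def)
  qed (use bounds(3) in auto)
  \<comment> \<open>The entry 1 guarantees positivity; the factor \<open>CARD('n)\<close> comes from
    summing over components.\<close>
  define C where "C = max 1 (max (real CARD('n) * E) (real CARD('n) * (c + L * (T * E))))"
  have "real CARD('n) * E \<le> C" "real CARD('n) * (c + L * (T * E)) \<le> C" "0 < C"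
    by (auto simp: C_def)
  then have "Wm1inf_norm T (as_functional T (lam k)) \<le> ereal C" "Linf_norm {0<..<T} (xi k) \<le> ereal C" for k
    using order_trans[OF 1[of k]] order_trans[OF 2[of k]] by auto
  with \<open>0 < C\<close> show ?thesis by blast
qed

end
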